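(* Let $(V,\omega)$ be a vertex operator algebra with an automorphism $g$ of finite order $T$, and let $n,m\in(1/T)\mathbb N$. Then (1) the associative algebras $\tilde A_{g,n}(V,\omega)$ and $A_{g,n}(V,\omega)$ are isomorphic; (2) the $\tilde A_{g,n}(V,\omega)$–$\tilde A_{g,m}(V,\omega)$-bimodule $\tilde A_{g,n,m}(V,\omega)$ and the $A_{g,n}(V,\omega)$–$A_{g,m}(V,\omega)$-bimodule $A_{g,n,m}(V,\omega)$ are isomorphic (i.e. there is a linear isomorphism between them intertwining the actions via algebra isomorphisms as in (1)).
   Context: A vertex operator algebra $(V,Y,\mathbf 1,\omega)$ is a vertex algebra with $V=\bigoplus_{n\in\mathbb Z}V_n$, $\dim V_n<\infty$, $V_n=0$ for $n\ll0$, $\omega\in V_2$, $L(m)=\omega_{m+1}$ satisfying the Virasoro relations, $L(0)|_{V_n}=n$, $Y(L(-1)w,z)=\frac d{dz}Y(w,z)$; $\mathrm{wt}\,u=n$ for $u\in V_n$. An automorphism $g$ is a vertex algebra automorphism with $g\omega=\omega$; $V^r=\{v:gv=e^{-2\pi\sqrt{-1}r/T}v\}$. $\tilde A_{g,n}(V,\omega)$, $\tilde A_{g,n,m}(V,\omega)$ denote the constructions below applied to the underlying vertex algebra $(V,Y,\mathbf 1)$ (where $\mathcal Dv=v_{-2}\mathbf 1=L(-1)v$). For $k,l\in\{0,\dots,T-1\}$, $\delta_k(l)=1$ if $k\ge l$, $0$ if $k<l$, $\delta_k(T)=0$; $n=\lfloor n\rfloor+\bar n/T$. $(1+z)^\alpha$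 is expanded in nonnegative powers of $z$. Vertex algebra side: for $u\in V^r$, $v\in V$, $m,n,p\in(1/T)\mathbb N$, $\bar p-\bar n\equiv r$: $u\bullet_{g,m,p}^{\,n}v=\sum_{i=0}^{\lfloor p\rfloor}(-1)^i\binom{\lfloor m\rfloor+\lfloor n\rfloor-\lfloor p\rfloor-1+\delta_{\bar m}(r)+\delta_{\bar n}(T-r)+i}{i}\operatorname{Res}_y\frac{(1+y)^{-1+\lfloor m\rfloor+\delta_{\bar m}(r)+r/T}}{y^{\lfloor m\rfloor+\lfloor n\rfloor-\lfloor p\rfloor+\delta_{\bar m}(r)+\delta_{\bar n}(T-r)+i}}Y(u,\log(1+y))v$, else $0$; $u\diamond_{g,m}^{\,n}v=\operatorname{Res}_y\frac{(1+y)^{-1+\delta_{\bar m}(r)+\lfloor m\rfloor+r/T}}{y^{\lfloor m\rfloor+\lfloor n\rfloor+\delta_{\bar m}(r)+\delta_{\bar n}(T-r)+1}}Y(u,\log(1+y))v$; $\tilde O'_{g,n,m}=\mathrm{span}\{u\diamond_{g,m}^{\,n}v\}+\mathrm{span}\{(\mathcal D+m-n)u\}$; $\tilde O''_{g,n,m}$ = span of all $u\bullet_{g,m,p_3}^{\,n}\big((a\bullet_{g,p_1,p_2}^{\,p_3}b)\bullet_{g,m,p_1}^{\,p_3}c-a\bullet_{g,m,p_2}^{\,p_3}(b\bullet_{g,m,p_1}^{\,p_2}c)\big)$; $\tilde O'''_{g,n,m}=\sum_{p_1,p_2}(V\bullet_{g,p_1,p_2}^{\,n}\tilde O'_{g,p_2,p_1})\bullet_{g,m,p_1}^{\,n}V$;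 $\tilde O_{g,n,m}=\tilde O'+\tilde O''+\tilde O'''$; $\tilde O_{g,n}=\tilde O'_{g,n,n}$; $\tilde A_{g,n}=V/\tilde O_{g,n}$ with product $\bullet_{g,n,n}^{\,n}$; $\tilde A_{g,n,m}=V/\tilde O_{g,n,m}$, left action $\bullet_{g,m,n}^{\,n}$, right action $\bullet_{g,m,m}^{\,n}$. VOA side: for homogeneous $u\in V^r$, $\bar p-\bar n\equiv r$: $u*_{g,m,p}^{\,n}v=\sum_{i=0}^{\lfloor p\rfloor}(-1)^i\binom{\lfloor m\rfloor+\lfloor n\rfloor-\lfloor p\rfloor-1+\delta_{\bar m}(r)+\delta_{\bar n}(T-r)+i}{i}\operatorname{Res}_z\frac{(1+z)^{\mathrm{wt}u-1+\lfloor m\rfloor+\delta_{\bar m}(r)+r/T}}{z^{\lfloor m\rfloor+\lfloor n\rfloor-\lfloor p\rfloor+\delta_{\bar m}(r)+\delta_{\bar n}(T-r)+i}}Y(u,z)v$, else $0$; $u\circ_{g,m}^{\,n}v=\operatorname{Res}_z\frac{(1+z)^{\mathrm{wt}u-1+\lfloor m\rfloor+\delta_{\bar m}(r)+r/T}}{z^{\lfloor m\rfloor+\lfloor n\rfloor+\delta_{\bar m}(r)+\delta_{\bar n}(T-r)+1}}Y(u,z)v$; $O'_{g,n,m}=\mathrm{span}\{u\circ_{g,m}^{\,n}v\}+\mathrm{span}\{(L(-1)+L(0)+m-n)u\}$; $O''_{g,n,m}$, $O'''_{g,n,m}$, $O_{g,n,m}$ as on the vertex algebra side with $*$ and $O'$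 in place of $\bullet$ and $\tilde O'$; $O_{g,n}=O'_{g,n,n}$; $A_{g,n}(V,\omega)=V/O_{g,n}$ with product $*_{g,n,n}^{\,n}$ (an associative algebra); $A_{g,n,m}(V,\omega)=V/O_{g,n,m}$, left action $*_{g,m,n}^{\,n}$, right action $*_{g,m,m}^{\,n}$. *)

theory Defs
  imports Complex_Main "HOL-Computational_Algebra.Formal_Laurent_Series"
begin

text \<open>Conventions.  A vector space V over the complex numbers is a type 'v with a
 scalar multiplication sm.  A vertex algebra structure is given by the modes
 Y u n v = u_n v, so that Y(u,z)v = sum_n u_n v z^(-n-1).  Elements
 n of (1/T)N are represented by their numerators N (n = N/T), so that
 floor n = N div T and bar n = N mod T.\<close>

definition fsum :: "(nat \<Rightarrow> 'v::comm_monoid_add) \<Rightarrow> 'v" where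
  "fsum f = sum f {i. f i \<noteq> 0}"

definition is_vertex_algebra ::
  "(complex \<Rightarrow> 'v::ab_group_add \<Rightarrow> 'v) \<Rightarrow> ('v \<Rightarrow> int \<Rightarrow> 'v \<Rightarrow> 'v) \<Rightarrow> 'v \<Rightarrow> bool" where
  "is_vertex_algebra sm Y vac \<longleftrightarrow>
     vector_space sm \<and>
     (\<forall>u n. Vector_Spaces.linear sm sm (Y u n)) \<and>
     (\<forall>n v. Vector_Spaces.linear sm sm (\<lambda>u. Y u n v)) \<and>
     (\<forall>u v. \<exists>N. \<forall>n\<ge>N. Y u n v = 0) \<and>
     (\<forall>n v. Y vac n v = (if n = -1 then v else 0)) \<and>
     (\<forall>u. Y u (-1) vac = u \<and> (\<forall>n\<ge>0. Y u n vac = 0)) \<and>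
     (\<forall>u v w p q r.
        fsum (\<lambda>i. sm (of_int p gchoose i) (Y (Y u (r + int i) v) (p + q - int i) w))
        = fsum (\<lambda>i. sm ((-1)^i * (of_int r gchoose i)) (Y u (p + r - int i) (Y v (q + int i) w)))
          - fsum (\<lambda>i. sm ((-1)^i * (-1) powi r * (of_int r gchoose i))
                         (Y v (q + r - int i) (Y u (p + int i) w))))"

definition Vir :: "('v \<Rightarrow> int \<Rightarrow> 'v \<Rightarrow> 'v) \<Rightarrow> 'v \<Rightarrow> int \<Rightarrow> 'v \<Rightarrow> 'v" where
  "Vir Y om m = Y om (m + 1)"

definition Vwt :: "(complex \<Rightarrow> 'v \<Rightarrow> 'v) \<Rightarrow> ('v \<Rightarrow> int \<Rightarrow> 'v \<Rightarrow> 'v) \<Rightarrow> 'v \<Rightarrow> int \<Rightarrow> 'v set" where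
  "Vwt sm Y om k = {v. Vir Y om 0 v = sm (of_int k) v}"

definition is_VOA ::
  "(complex \<Rightarrow> 'v::ab_group_add \<Rightarrow> 'v) \<Rightarrow> ('v \<Rightarrow> int \<Rightarrow> 'v \<Rightarrow> 'v) \<Rightarrow> 'v \<Rightarrow> 'v \<Rightarrow> bool" where
  "is_VOA sm Y vac om \<longleftrightarrow>
     is_vertex_algebra sm Y vac \<and>
     \<comment> \<open>V is the direct sum of the V_k, k integer (sum of L(0)-eigenspaces)\<close>
     (\<forall>v. \<exists>S f. finite S \<and> (\<forall>k\<in>S. f k \<in> Vwt sm Y om k) \<and> v = (\<Sum>k\<in>S. f k)) \<and>
     (\<forall>k. \<exists>B. finite B \<and> Vwt sm Y om k \<subseteq> module.span sm B) \<and>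
     (\<exists>N. \<forall>k<N. Vwt sm Y om k = {0}) \<and>
     om \<in> Vwt sm Y om 2 \<and>
     (\<exists>c::complex. \<forall>m n v.
        Vir Y om m (Vir Y om n v) - Vir Y om n (Vir Y om m v)
        = sm (of_int (m - n)) (Vir Y om (m + n) v)
          + sm (if m + n = 0 then (of_int (m^3 - m) / 12) * c else 0) v) \<and>
     (\<forall>w n. Y (Vir Y om (-1) w) n = sm (- of_int n) \<circ> Y w (n - 1))"

definition is_automorphism ::
  "(complex \<Rightarrow> 'v::ab_group_add \<Rightarrow> 'v) \<Rightarrow> ('v \<Rightarrow> int \<Rightarrow> 'v \<Rightarrow> 'v) \<Rightarrow> 'v \<Rightarrow> 'v \<Rightarrow> ('v \<Rightarrow> 'v) \<Rightarrow> bool" where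
  "is_automorphism sm Y vac om g \<longleftrightarrow>
     Vector_Spaces.linear sm sm g \<and> bij g \<and>
     (\<forall>u n v. g (Y u n v) = Y (g u) n (g v)) \<and> g vac = vac \<and> g om = om"

definition has_order :: "('v \<Rightarrow> 'v) \<Rightarrow> nat \<Rightarrow> bool" where
  "has_order g T \<longleftrightarrow> T > 0 \<and> g ^^ T = id \<and> (\<forall>k. 0 < k \<and> k < T \<longrightarrow> g ^^ k \<noteq> id)"

definition Vr :: "(complex \<Rightarrow> 'v \<Rightarrow> 'v) \<Rightarrow> ('v \<Rightarrow> 'v) \<Rightarrow> nat \<Rightarrow> nat \<Rightarrow> 'v set" where
  "Vr sm g T r = {v. g v = sm (exp (- 2 * pi * \<i> * of_nat r / of_nat T)) v}"

definition projr :: "(complex \<Rightarrow> 'v::comm_monoid_add \<Rightarrow> 'v) \<Rightarrow> ('v \<Rightarrow> 'v) \<Rightarrow> nat \<Rightarrow> nat \<Rightarrow> 'v \<Rightarrow> 'v" where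
  "projr sm g T r v = sm (1 / of_nat T)
      (\<Sum>k<T. sm (exp (2 * pi * \<i> * of_nat r * of_nat k / of_nat T)) ((g ^^ k) v))"

text \<open>Component of v in V_k (well defined since V is the direct sum of the V_k).\<close>
definition wcomp :: "(complex \<Rightarrow> 'v::comm_monoid_add \<Rightarrow> 'v) \<Rightarrow> ('v \<Rightarrow> int \<Rightarrow> 'v \<Rightarrow> 'v) \<Rightarrow> 'v \<Rightarrow> int \<Rightarrow> 'v \<Rightarrow> 'v" where
  "wcomp sm Y om k v = (SOME w. \<exists>S f. finite S \<and> (\<forall>j\<in>S. f j \<in> Vwt sm Y om j)
        \<and> v = (\<Sum>j\<in>S. f j) \<and> w = (if k \<in> S then f k else 0))"

text \<open>delta_k(l) for k in {0..T-1}, l in {0..T}.\<close>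
definition dlt :: "nat \<Rightarrow> nat \<Rightarrow> nat \<Rightarrow> int" where
  "dlt T k l = (if l = T then 0 else if l \<le> k then 1 else 0)"

text \<open>Res_y F_j(y) applied termwise to Y: sum_j Res(F_j) u_j v, where F_j is the
 Laurent series multiplying u_j v.\<close>
definition resY :: "(complex \<Rightarrow> 'v::comm_monoid_add \<Rightarrow> 'v) \<Rightarrow> ('v \<Rightarrow> int \<Rightarrow> 'v \<Rightarrow> 'v)
     \<Rightarrow> (int \<Rightarrow> complex fls) \<Rightarrow> 'v \<Rightarrow> 'v \<Rightarrow> 'v" where
  "resY sm Y F u v = (\<Sum>j\<in>{j. Y u j v \<noteq> 0 \<and> fls_nth (F j) (-1) \<noteq> 0}.
       sm (fls_nth (F j) (-1)) (Y u j v))"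

text \<open>Res_y (1+y)^a / y^k Y(u, log(1+y)) v.\<close>
definition resVA :: "(complex \<Rightarrow> 'v::comm_monoid_add \<Rightarrow> 'v) \<Rightarrow> ('v \<Rightarrow> int \<Rightarrow> 'v \<Rightarrow> 'v)
     \<Rightarrow> complex \<Rightarrow> int \<Rightarrow> 'v \<Rightarrow> 'v \<Rightarrow> 'v" where
  "resVA sm Y a k u v = resY sm Y
     (\<lambda>j. fps_to_fls (fps_binomial a) * fls_X powi (- k) * fps_to_fls (fps_ln 1) powi (- j - 1)) u v"

text \<open>Res_z (1+z)^a / z^k Y(u, z) v.\<close>
definition resVOA :: "(complex \<Rightarrow> 'v::comm_monoid_add \<Rightarrow> 'v) \<Rightarrow> ('v \<Rightarrow> int \<Rightarrow> 'v \<Rightarrow> 'v)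
     \<Rightarrow> complex \<Rightarrow> int \<Rightarrow> 'v \<Rightarrow> 'v \<Rightarrow> 'v" where
  "resVOA sm Y a k u v = resY sm Y
     (\<lambda>j. fps_to_fls (fps_binomial a) * fls_X powi (- k) * fls_X powi (- j - 1)) u v"

definition cond :: "nat \<Rightarrow> nat \<Rightarrow> nat \<Rightarrow> nat \<Rightarrow> bool" where
  "cond T r P N \<longleftrightarrow> (int (P mod T) - int (N mod T)) mod int T = int r mod int T"

definition Aexp :: "nat \<Rightarrow> nat \<Rightarrow> nat \<Rightarrow> nat \<Rightarrow> nat \<Rightarrow> int" where
  "Aexp T r M P N = int (M div T) + int (N div T) - int (P div T) - 1
      + dlt T (M mod T) r + dlt T (N mod T) (T - r)"

text \<open>Vertex algebra side, u in V^r:  u bullet^n_{g,m,p} v  and  u diamond^n_{g,m} v.\<close>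
definition bul_r :: "(complex \<Rightarrow> 'v::ab_group_add \<Rightarrow> 'v) \<Rightarrow> ('v \<Rightarrow> int \<Rightarrow> 'v \<Rightarrow> 'v) \<Rightarrow> nat
     \<Rightarrow> nat \<Rightarrow> nat \<Rightarrow> nat \<Rightarrow> nat \<Rightarrow> 'v \<Rightarrow> 'v \<Rightarrow> 'v" where
  "bul_r sm Y T r M P N u v =
     (if cond T r P N then
        (\<Sum>i\<in>{0..P div T}. sm ((-1)^i * (of_int (Aexp T r M P N + int i) gchoose i))
           (resVA sm Y (-1 + of_nat (M div T) + of_int (dlt T (M mod T) r) + of_nat r / of_nat T)
                 (Aexp T r M P N + 1 + int i) u v))
      else 0)"

definition dia_r :: "(complex \<Rightarrow> 'v::ab_group_add \<Rightarrow> 'v) \<Rightarrow> ('v \<Rightarrow> int \<Rightarrow> 'v \<Rightarrow> 'v) \<Rightarrow> nat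
     \<Rightarrow> nat \<Rightarrow> nat \<Rightarrow> nat \<Rightarrow> 'v \<Rightarrow> 'v \<Rightarrow> 'v" where
  "dia_r sm Y T r M N u v =
     resVA sm Y (-1 + of_int (dlt T (M mod T) r) + of_nat (M div T) + of_nat r / of_nat T)
        (int (M div T) + int (N div T) + dlt T (M mod T) r + dlt T (N mod T) (T - r) + 1) u v"

text \<open>VOA side, u in V^r homogeneous of weight k:  u *^n_{g,m,p} v  and  u o^n_{g,m} v.\<close>
definition star_rk :: "(complex \<Rightarrow> 'v::ab_group_add \<Rightarrow> 'v) \<Rightarrow> ('v \<Rightarrow> int \<Rightarrow> 'v \<Rightarrow> 'v) \<Rightarrow> nat
     \<Rightarrow> nat \<Rightarrow> int \<Rightarrow> nat \<Rightarrow> nat \<Rightarrow> nat \<Rightarrow> 'v \<Rightarrow> 'v \<Rightarrow> 'v" where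
  "star_rk sm Y T r k M P N u v =
     (if cond T r P N then
        (\<Sum>i\<in>{0..P div T}. sm ((-1)^i * (of_int (Aexp T r M P N + int i) gchoose i))
           (resVOA sm Y (of_int k - 1 + of_nat (M div T) + of_int (dlt T (M mod T) r) + of_nat r / of_nat T)
                 (Aexp T r M P N + 1 + int i) u v))
      else 0)"

definition circ_rk :: "(complex \<Rightarrow> 'v::ab_group_add \<Rightarrow> 'v) \<Rightarrow> ('v \<Rightarrow> int \<Rightarrow> 'v \<Rightarrow> 'v) \<Rightarrow> nat
     \<Rightarrow> nat \<Rightarrow> int \<Rightarrow> nat \<Rightarrow> nat \<Rightarrow> 'v \<Rightarrow> 'v \<Rightarrow> 'v" where
  "circ_rk sm Y T r k M N u v =
     resVOA sm Y (of_int k - 1 + of_nat (M div T) + of_int (dlt T (M mod T) r) + of_nat r / of_nat T)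
        (int (M div T) + int (N div T) + dlt T (M mod T) r + dlt T (N mod T) (T - r) + 1) u v"

definition bul where
  "bul sm Y g T M P N u v = (\<Sum>r<T. bul_r sm Y T r M P N (projr sm g T r u) v)"

definition dia where
  "dia sm Y g T M N u v = (\<Sum>r<T. dia_r sm Y T r M N (projr sm g T r u) v)"

definition star where
  "star sm Y om g T M P N u v = (\<Sum>r<T. \<Sum>k\<in>{k. wcomp sm Y om k (projr sm g T r u) \<noteq> 0}.
       star_rk sm Y T r k M P N (wcomp sm Y om k (projr sm g T r u)) v)"

definition circ where
  "circ sm Y om g T M N u v = (\<Sum>r<T. \<Sum>k\<in>{k. wcomp sm Y om k (projr sm g T r u) \<noteq> 0}.
       circ_rk sm Y T r k M N (wcomp sm Y om k (projr sm g T r u)) v)"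

text \<open>Generic construction of O_{g,n,m} from a product family pr M P N (= ._{g,m,p}^n)
 and the generators of O'_{g,n,m}.\<close>
definition O3 :: "(complex \<Rightarrow> 'v::ab_group_add \<Rightarrow> 'v) \<Rightarrow> (nat \<Rightarrow> nat \<Rightarrow> nat \<Rightarrow> 'v \<Rightarrow> 'v \<Rightarrow> 'v)
     \<Rightarrow> (nat \<Rightarrow> nat \<Rightarrow> 'v set) \<Rightarrow> nat \<Rightarrow> nat \<Rightarrow> 'v set" where
  "O3 sm pr O1 N M = module.span sm
     (O1 N M
      \<union> {pr M P3 N u (pr M P1 P3 (pr P1 P2 P3 a b) c - pr M P2 P3 a (pr M P1 P2 b c))
           | u a b c P1 P2 P3. True}
      \<union> {pr M P1 N (pr P1 P2 N a x) b | a b x P1 P2. x \<in> O1 P2 P1})"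

definition tO1 where
  "tO1 sm Y vac g T N M = module.span sm
     ({dia sm Y g T M N u v | u v. True}
      \<union> {Y u (-2) vac + sm ((of_nat M - of_nat N) / of_nat T) u | u. True})"

definition tO where
  "tO sm Y vac g T N M = O3 sm (bul sm Y g T) (tO1 sm Y vac g T) N M"

definition O1 where
  "O1 sm Y om g T N M = module.span sm
     ({circ sm Y om g T M N u v | u v. True}
      \<union> {Vir Y om (-1) u + Vir Y om 0 u + sm ((of_nat M - of_nat N) / of_nat T) u | u. True})"

definition Ovoa where
  "Ovoa sm Y om g T N M = O3 sm (star sm Y om g T) (O1 sm Y om g T) N M"

text \<open>An isomorphism of quotient spaces V/A -> V/B induced by a linear map phi.\<close>
definition quot_iso :: "(complex \<Rightarrow> 'v::ab_group_add \<Rightarrow> 'v) \<Rightarrow> 'v set \<Rightarrow> 'v set \<Rightarrow> ('v \<Rightarrow> 'v) \<Rightarrow> bool" where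
  "quot_iso sm A B phi \<longleftrightarrow> Vector_Spaces.linear sm sm phi \<and>
     (\<forall>x. phi x \<in> B \<longleftrightarrow> x \<in> A) \<and> (\<forall>y. \<exists>x. y - phi x \<in> B)"

definition alg_iso where
  "alg_iso sm A p1 B p2 phi \<longleftrightarrow> quot_iso sm A B phi \<and>
     (\<forall>a b. phi (p1 a b) - p2 (phi a) (phi b) \<in> B)"

end

theory Submission
  imports Defs
begin

text \<open>
  Change of coordinates y = e^x - 1 on a vertex operator algebra. Let L[0] be the residue of
  (1+y) log(1+y) Y(om,y), which is L(0) plus operators lowering the weight. For u in V_k there is a
  unique L[0]-eigenvector Phi u of eigenvalue k whose component of top weight is u, and this
  defines a linear bijection Phi. It satisfies
    Phi (Y(u, log(1+y)) v) = Y((1+y)^L(0) Phi u, y) Phi v: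
  the commutator formula shows that the modes with respect to x = log(1+y) of both sides are
  L[0]-eigenvectors with the same eigenvalue, and they have the same leading component.
  Hence Phi carries every construction on the vertex algebra side to its counterpart on the
  vertex operator algebra side. It commutes with g because g fixes om.
\<close>

text \<open>Two points carry the argument. First, the factor (1+y)^L(0) is what makes the commutator
  with L[0] close up. Commuting the residue of H(y) Y(om,y) past Y(u,y) gives the i-th Hasse
  derivatives of H multiplied by om_i u. For H = (1+y) log(1+y) and i >= 2 these are constants times
  (1+y)^(1-i), and om_i lowers the weight by i-1; so (1+y)^k, the factor for u of weight k, becomes
  exactly the factor for om_i u, with the coefficient that om_i has in L[0]. Second,
  \<open>Phi\<close> is not built as an exponential of Virasoro modes, whose conjugation action on Y
  would have to be computed. It is pinned down by eigenvalue and leading term, which works because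
  L[0] is triangular with respect to the weight and the weights are bounded below. Identities
  between residues are linear in the Laurent series and vanish at high order, so they need checking
  on one series of each order only: y^d for the commutator formula, x^d dx for the passage from
  single modes to arbitrary residues.\<close>

unbundle fps_syntax

section \<open>Laurent series\<close>

text \<open>A lower bound on the order that 0 satisfies for every \<open>K\<close>.
  \<open>fls_subdegree\<close> has the default value 0 at the zero series and so behaves badly when
  leading terms cancel.\<close>

definition ord_ge :: "int \<Rightarrow> 'a::zero fls \<Rightarrow> bool" where
  "ord_ge K G \<longleftrightarrow> (\<forall>j<K. G $$ j = 0)"

lemma ord_geD: "ord_ge K G \<Longrightarrow> j < K \<Longrightarrow> G $$ j = 0"
  by (simp add: ord_ge_def)

lemma ord_ge_mono: "ord_ge K G \<Longrightarrow> L \<le> K \<Longrightarrow> ord_ge L G"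
  by (simp add: ord_ge_def)

lemma ord_ge_subdegree: "ord_ge (fls_subdegree G) G"
  by (simp add: ord_ge_def)

lemma ord_ge_zero [simp]: "ord_ge K 0"
  by (simp add: ord_ge_def)

lemma ord_ge_iff: "ord_ge K G \<longleftrightarrow> G = 0 \<or> K \<le> fls_subdegree G"
  by (auto simp: ord_ge_def intro: fls_subdegree_geI)

lemma ord_ge_mult:
  fixes G H :: "'a::{comm_monoid_add,mult_zero} fls"
  assumes "ord_ge K G" "ord_ge L H"
  shows "ord_ge (K + L) (G * H)"
proof (cases "G = 0 \<or> H = 0")
  case False
  then have "K \<le> fls_subdegree G" "L \<le> fls_subdegree H"
    using assms by (auto simp: ord_ge_iff)
  then show ?thesis by (auto simp: ord_ge_def intro: fls_times_nth_eq0)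
qed auto

lemma ord_ge_deriv: "ord_ge K G \<Longrightarrow> ord_ge (K - 1) (fls_deriv G)"
  by (simp add: ord_ge_def)

text \<open>Hasse derivative: the i-th derivative divided by i!.\<close>
definition fls_hderiv :: "nat \<Rightarrow> 'a::field_char_0 fls \<Rightarrow> 'a fls" where
  "fls_hderiv i G = Abs_fls (\<lambda>n. (of_int (n + int i) gchoose i) * G $$ (n + int i))"

lemma fls_hderiv_nth [simp]:
  "fls_hderiv i G $$ n = (of_int (n + int i) gchoose i) * G $$ (n + int i)"
proof -
  obtain N where "\<forall>n<N. G $$ n = 0" by (elim fls_nth_vanishes_belowE)
  hence "\<forall>n<N - int i. (of_int (n + int i) gchoose i) * G $$ (n + int i) = 0" by auto
  from nth_Abs_fls_lower_bound[OF this] show ?thesis unfolding fls_hderiv_def .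
qed

lemma fls_hderiv_0 [simp]: "fls_hderiv 0 G = G"
  by (rule fls_eqI) simp

lemma fls_hderiv_1: "fls_hderiv (Suc 0) G = fls_deriv G"
  by (rule fls_eqI) simp

lemma fls_hderiv_add: "fls_hderiv i (G + H) = fls_hderiv i G + fls_hderiv i H"
  by (rule fls_eqI) (simp add: algebra_simps)

lemma fls_hderiv_const_mult: "fls_hderiv i (fls_const c * G) = fls_const c * fls_hderiv i G"
  by (rule fls_eqI) (simp add: algebra_simps)

lemma ord_ge_hderiv: "ord_ge K G \<Longrightarrow> ord_ge (K - int i) (fls_hderiv i G)"
  by (simp add: ord_ge_def)

lemma fls_hderiv_X_powi:
  "fls_hderiv i (fls_X powi p :: 'a::field_char_0 fls)
     = fls_const (of_int p gchoose i) * fls_X powi (p - int i)"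
proof (rule fls_eqI)
  fix n
  show "fls_hderiv i (fls_X powi p :: 'a fls) $$ n
     = (fls_const (of_int p gchoose i) * fls_X powi (p - int i)) $$ n"
    by (cases "n + int i = p") (auto simp del: of_int_add)
qed

lemma fls_deriv_power_int:
  fixes f :: "'a::field_char_0 fls"
  assumes "f \<noteq> 0"
  shows "fls_deriv (f powi n) = of_int n * f powi (n - 1) * fls_deriv f"
proof (induction n rule: int_induct[where k = 0])
  case base
  show ?case by simp
next
  case (step1 i)
  have "fls_deriv (f powi (i + 1)) = fls_deriv (f powi i * f)"
    using assms by (simp add: power_int_add)
  also have "\<dots> = f powi i * fls_deriv f + of_int i * (f powi (i - 1) * f) * fls_deriv f"
    by (simp add: step1)
  also have "f powi (i - 1) * f = f powi i"
    using assms by (simp add: power_int_diff)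
  finally show ?case by (simp add: algebra_simps)
next
  case (step2 i)
  have "fls_deriv (f powi i) = fls_deriv (f powi (i - 1) * f)"
    using assms by (simp add: power_int_diff)
  also have "\<dots> = f powi (i - 1) * fls_deriv f + fls_deriv (f powi (i - 1)) * f"
    by simp
  finally have "fls_deriv (f powi (i - 1)) * f = of_int (i - 1) * f powi (i - 1) * fls_deriv f"
    by (simp add: step2 algebra_simps)
  then have "fls_deriv (f powi (i - 1)) = of_int (i - 1) * f powi (i - 1) * fls_deriv f / f"
    using assms by (simp add: field_simps)
  also have "\<dots> = of_int (i - 1) * f powi (i - 1 - 1) * fls_deriv f"
    using assms by (simp add: power_int_diff power2_eq_square)
  finally show ?case .
qed

section \<open>The series log(1+y), the forms x^n dx and the field x d/dx\<close>

definition lg :: "complex fls" where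
  "lg = fps_to_fls (fps_ln 1)"

lemma lg_nth: "lg $$ n = (if n \<le> 0 then 0 else (-1) ^ (nat n - 1) / of_int n)"
  by (auto simp: lg_def fps_ln_nth of_nat_nat)

lemma one_plus_X_nz [simp]: "1 + fls_X \<noteq> (0 :: complex fls)"
proof
  assume "1 + fls_X = (0 :: complex fls)"
  then have "(1 + fls_X :: complex fls) $$ 0 = 0" by simp
  then show False by simp
qed

lemma lg_subdegree [simp]: "fls_subdegree lg = 1"
  by (rule fls_subdegree_eqI) (auto simp: lg_nth)

lemma lg_nz [simp]: "lg \<noteq> 0"
  by (metis lg_subdegree fls_zero_subdegree zero_neq_one)

lemma lg_deriv: "fls_deriv lg = inverse (1 + fls_X)"
proof -
  have "fls_deriv lg = fps_to_fls (inverse (1 + fps_X))"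
    by (simp add: lg_def fls_deriv_fps_to_fls fps_ln_deriv)
  also have "\<dots> = inverse (fps_to_fls (1 + fps_X))"
    by (rule fls_inverse_fps_to_fls[symmetric]) simp
  finally show ?thesis by simp
qed

lemma lg_powi_lead: "(lg powi n) $$ n = 1"
proof -
  have *: "(lg powi (i + 1)) $$ (i + 1) = (lg powi i) $$ i" for i
  proof -
    have "lg powi (i + 1) = lg powi i * lg" by (simp add: power_int_add)
    moreover have "(lg powi i * lg) $$ (fls_subdegree (lg powi i) + fls_subdegree lg)
        = (lg powi i) $$ i * lg $$ 1"
      by (subst fls_times_base) simp
    ultimately show ?thesis by (simp add: lg_nth)
  qed
  show ?thesis
  proof (induction n rule: int_induct[where k = 0])
    case (step2 i)
    then show ?case using *[of "i - 1"] by simp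
  qed (simp_all add: *)
qed

text \<open>dlg n dy = x^n dx for x = log(1+y).\<close>
definition dlg :: "int \<Rightarrow> complex fls" where
  "dlg n = lg powi n * fls_deriv lg"

lemma subdegree_lg_deriv: "fls_subdegree (fls_deriv lg) = 0"
  by (rule fls_subdegree_eqI) (auto simp: lg_nth)

lemma dlg_ord: "ord_ge n (dlg n)"
  unfolding dlg_def ord_ge_def
  using fls_times_nth_eq0[of _ "lg powi n" "fls_deriv lg"] by (simp add: subdegree_lg_deriv)

lemma dlg_lead: "dlg n $$ n = 1"
  using fls_times_base[of "lg powi n" "fls_deriv lg"]
  by (simp add: dlg_def subdegree_lg_deriv lg_powi_lead) (simp add: lg_nth)

text \<open>The product is \<open>lg powi (n - j - 1) * fls_deriv lg\<close>. For
  \<open>j \<noteq> n\<close> it is a multiple of a derivative and has no residue; for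
  \<open>j = n\<close> it is the logarithmic derivative of \<open>lg\<close>, with residue the order
  1. Hence the forms \<open>dlg n\<close> are dual to the powers of log(1+y) occurring in Y(u,
  log(1+y)).\<close>

lemma dlg_residue: "(dlg n * lg powi (- j - 1)) $$ (-1) = (if j = n then 1 else 0)"
proof -
  have eq: "dlg n * lg powi (- j - 1) = lg powi (n - j - 1) * fls_deriv lg"
    by (simp add: dlg_def flip: power_int_add) (simp add: algebra_simps)
  show ?thesis
  proof (cases "j = n")
    case True
    then have "dlg n * lg powi (- j - 1) = inverse lg * fls_deriv lg"
      using eq by (simp add: power_int_minus)
    then show ?thesis using True fls_residue_deriv_times_inverse_eq_subdegree(2)[of lg]
      by simp
  next
    case False
    have "fls_residue (of_int (n - j) * (lg powi (n - j - 1) * fls_deriv lg)) = 0"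
      using fls_residue_deriv[of "lg powi (n - j)"]
      by (simp only: fls_deriv_power_int[OF lg_nz] mult.assoc)
    then have "of_int (n - j) * fls_residue (lg powi (n - j - 1) * fls_deriv lg) = 0"
      by (simp only: fls_residue_of_int_times)
    then show ?thesis using False by (simp add: eq)
  qed
qed

text \<open>The vector field x d/dx in the coordinate y.\<close>
definition xlog :: "complex fls" where
  "xlog = (1 + fls_X) * lg"

text \<open>The left side is the Lie derivative of x^n dx along x d/dx, for which x^n dx is an
  eigenform. This eigenvalue later accounts for the shift by n + 1 in the weight of u_n v.\<close>

lemma dlg_xlog_deriv: "fls_deriv (dlg n * xlog) = of_int (n + 1) * dlg n"
proof -
  have "dlg n * xlog = lg powi (n + 1)"
    by (simp add: dlg_def xlog_def lg_deriv power_int_add)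
  then show ?thesis by (simp add: fls_deriv_power_int dlg_def)
qed

text \<open>Two neighbouring coefficients of \<open>lg\<close> are added. The values 0 at n = 0 and
  1 at n = 1 say that L[0] contains no L(-1) and starts with L(0).\<close>

lemma xlog_nth:
  "xlog $$ n = (if n \<le> 0 then 0 else if n = 1 then 1 else (-1) ^ nat n / (of_int n * of_int (n - 1)))"
proof -
  have "xlog $$ n = lg $$ n + lg $$ (n - 1)"
    unfolding xlog_def by (simp add: ring_distribs fls_X_times_conv_shift)
  moreover have "(-1) ^ (nat n - 1) / of_int n + (-1) ^ (nat (n - 1) - 1) / of_int (n - 1)
     = ((-1) ^ nat n / (of_int n * of_int (n - 1)) :: complex)" if "n > 1"
  proof -
    define k where "k = nat (n - 2)"
    have n: "n = int k + 2" using \<open>n > 1\<close> by (simp add: k_def)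
    have nz: "(2 + of_nat k :: complex) \<noteq> 0" "(1 + of_nat k :: complex) \<noteq> 0"
      by (metis of_nat_add of_nat_numeral of_nat_eq_0_iff add_is_0 zero_neq_numeral)
         (metis of_nat_Suc of_nat_eq_0_iff nat.distinct(1))
    have e: "nat n = k + 2" "nat (n - 1) = k + 1" by (simp_all add: n nat_add_distrib)
    show ?thesis unfolding e using nz by (simp add: n divide_simps) (simp add: algebra_simps)
  qed
  ultimately show ?thesis
    by (auto simp: lg_nth)
qed

lemma xlog_hderiv_1: "fls_hderiv 1 xlog = 1 + lg"
  by (simp add: fls_hderiv_1 xlog_def lg_deriv)

text \<open>The first derivative is 1 + log(1+y), so the second is (1+y)^(-1) and all higher ones
  are multiples of (1+y)^(1-i); the value at y = 0 fixes the constant. The proof compares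
  coefficients directly.\<close>

lemma xlog_hderiv:
  assumes "i \<ge> 2"
  shows "fls_hderiv i xlog = fls_const (xlog $$ int i) * (1 + fls_X) powi (1 - int i)"
proof (rule fls_eqI)
  fix n :: int
  obtain j where j: "i = j + 2" using assms by (metis add.commute le_Suc_ex)
  consider "n < - int i" | "- int i \<le> n" "n < 0" | "n \<ge> 0" by linarith
  then show "fls_hderiv i xlog $$ n
      = (fls_const (xlog $$ int i) * (1 + fls_X) powi (1 - int i)) $$ n"
  proof cases
    case 1
    then show ?thesis by (simp add: xlog_nth one_plus_fls_X_powi_eq)
  next
    case 2
    then have "(of_int (n + int i) gchoose i :: complex) = of_nat (nat (n + int i) choose i)"
      by (simp add: binomial_gbinomial)
    also have "\<dots> = 0" using 2 by (simp add: binomial_eq_0)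
    finally show ?thesis using 2 by (simp add: one_plus_fls_X_powi_eq)
  next
    case 3
    then obtain k where k: "n = int k" by (metis nonneg_int_cases)
    \<comment> \<open>Negating the upper index turns the binomial with negative entry
      \<open>1 - i = - (j + 1)\<close> into \<open>k + j\<close> over \<open>k\<close> up to sign,
      so that both sides become quotients of factorials.\<close>
    have "(of_int (1 - int i) gchoose k :: complex)
        = (-1) ^ k * ((of_nat k - of_int (1 - int i) - 1) gchoose k)"
      by (rule gbinomial_negated_upper)
    also have "(of_nat k - of_int (1 - int i) - 1 :: complex) = of_nat (k + j)"
      by (simp add: j)
    also have "(of_nat (k + j) gchoose k :: complex) = fact (k + j) / (fact k * fact j)"
      by (metis add_diff_cancel_left' binomial_fact binomial_gbinomial le_add1)
    finally have r: "(of_int (1 - int i) gchoose k :: complex)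
        = (-1) ^ k * (fact (k + j) / (fact k * fact j))" .
    have "(of_int (n + int i) gchoose i :: complex) = of_nat (k + j + 2 choose (j + 2))"
      unfolding j k binomial_gbinomial by (simp only: of_nat_add of_int_add of_int_of_nat_eq ac_simps)
    also have "\<dots> = fact (k + j + 2) / (fact (j + 2) * fact k)"
      by (subst binomial_fact) simp_all
    also have "fact (k + j + 2) = (of_nat (k + j + 2) * of_nat (k + j + 1) * fact (k + j) :: complex)"
      by (simp add: algebra_simps)
    also have "fact (j + 2) = (of_nat (j + 2) * of_nat (j + 1) * fact j :: complex)"
      by (simp add: algebra_simps)
    finally have l: "(of_int (n + int i) gchoose i :: complex)
       = of_nat (k + j + 2) * of_nat (k + j + 1) * fact (k + j)
         / (of_nat (j + 2) * of_nat (j + 1) * fact j * fact k)" .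
    have h1: "xlog $$ (n + int i) = (-1) ^ (k + j) / (of_nat (k + j + 2) * of_nat (k + j + 1))"
      by (simp add: xlog_nth j k nat_add_distrib algebra_simps)
    have h2: "xlog $$ int i = (-1) ^ j / (of_nat (j + 2) * of_nat (j + 1))"
      by (simp add: xlog_nth j nat_add_distrib algebra_simps)
    have nz: "(of_nat (k + j + 2) :: complex) \<noteq> 0" "(of_nat (k + j + 1) :: complex) \<noteq> 0"
      by (simp_all only: of_nat_eq_0_iff)
    have cancel: "a * b * f / (c * d * p * q) * (e * e' / (a * b)) = e' / (c * d) * (e * (f / (q * p)))"
      if "a \<noteq> 0" "b \<noteq> 0" for a b c d e e' f p q :: complex
      using that by (simp add: field_simps)
    have "fls_hderiv i xlog $$ n = (of_int (n + int i) gchoose i) * xlog $$ (n + int i)" by simp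
    also have "\<dots> = xlog $$ int i * (of_int (1 - int i) gchoose k)"
      unfolding l h1 h2 r power_add by (rule cancel[OF nz(1,2)])
    also have "\<dots> = (fls_const (xlog $$ int i) * (1 + fls_X) powi (1 - int i)) $$ n"
      by (simp add: one_plus_fls_X_powi_eq k)
    finally show ?thesis .
  qed
qed

section \<open>Modes along a Laurent series\<close>

lemma fsum_eq_sum_lessThan:
  assumes "\<And>i. i \<ge> I \<Longrightarrow> f i = 0"
  shows "fsum f = sum f {..<I}"
  unfolding fsum_def
  by (rule sum.mono_neutral_left) (use assms in \<open>auto simp: not_less[symmetric]\<close>)

locale voa =
  fixes sm :: "complex \<Rightarrow> 'v::ab_group_add \<Rightarrow> 'v"
    and Y :: "'v \<Rightarrow> int \<Rightarrow> 'v \<Rightarrow> 'v"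
    and vac om :: 'v
  assumes voa: "is_VOA sm Y vac om"
begin

lemma va: "is_vertex_algebra sm Y vac"
  using voa by (simp add: is_VOA_def)

sublocale vector_space sm
  using va by (simp add: is_vertex_algebra_def)

abbreviation "lin \<equiv> Vector_Spaces.linear sm sm"

lemma lin_iff: "lin f \<longleftrightarrow> (\<forall>x y. f (x + y) = f x + f y) \<and> (\<forall>c x. f (sm c x) = sm c (f x))"
  using vector_space_axioms by (auto simp: Vector_Spaces.linear_iff)

lemma linI: "(\<And>x y. f (x + y) = f x + f y) \<Longrightarrow> (\<And>c x. f (sm c x) = sm c (f x)) \<Longrightarrow> lin f"
  by (simp add: lin_iff)

lemma lin_add: "lin f \<Longrightarrow> f (x + y) = f x + f y"
  and lin_scale: "lin f \<Longrightarrow> f (sm c x) = sm c (f x)"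
  by (simp_all add: lin_iff)

lemma lin_zero: "lin f \<Longrightarrow> f 0 = 0"
  using lin_scale[of f 0 0] by simp

lemma lin_minus: "lin f \<Longrightarrow> f (- x) = - f x"
  using lin_scale[of f "-1" x] by (simp add: scale_minus_left)

lemma lin_diff: "lin f \<Longrightarrow> f (x - y) = f x - f y"
  using lin_add[of f x "- y"] by (simp add: lin_minus)

lemma lin_sum: "lin f \<Longrightarrow> f (sum g A) = (\<Sum>a\<in>A. f (g a))"
  by (induction A rule: infinite_finite_induct) (simp_all add: lin_zero lin_add)

lemma lin_id: "lin (\<lambda>x. x)"
  by (rule linI) simp_all

lemma lin_comp: "lin f \<Longrightarrow> lin g \<Longrightarrow> lin (\<lambda>x. f (g x))"
  by (simp add: lin_iff)

lemma lin_plus: "lin f \<Longrightarrow> lin g \<Longrightarrow> lin (\<lambda>x. f x + g x)"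
  by (simp add: lin_iff scale_right_distrib)

lemma lin_sub: "lin f \<Longrightarrow> lin g \<Longrightarrow> lin (\<lambda>x. f x - g x)"
  by (simp add: lin_iff scale_right_diff_distrib)

lemma lin_scaled: "lin f \<Longrightarrow> lin (\<lambda>x. sm c (f x))"
  by (simp add: lin_iff scale_right_distrib mult.commute)

lemma lin_sums: "(\<And>a. a \<in> A \<Longrightarrow> lin (f a)) \<Longrightarrow> lin (\<lambda>x. \<Sum>a\<in>A. f a x)"
  by (rule linI) (simp_all add: lin_add lin_scale sum.distrib scale_sum_right)

lemma Y_lin: "lin (Y u n)" and Y_lin_left: "lin (\<lambda>u. Y u n v)"
  using va by (simp_all add: is_vertex_algebra_def)

lemma Y_truncation: "\<exists>J. \<forall>j\<ge>J. Y u j v = 0"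
  using va by (simp add: is_vertex_algebra_def)

lemma Y_truncation_nat: "\<exists>I::nat. \<forall>i\<ge>I. Y u (int i) v = 0"
proof -
  obtain J where "\<forall>j\<ge>J. Y u j v = 0" using Y_truncation by blast
  then show ?thesis by (intro exI[of _ "nat J"]) (simp add: nat_le_iff)
qed

text \<open>This is the identity of \<open>is_vertex_algebra\<close> at r = 0, where
  \<open>0 gchoose i\<close> leaves only i = 0 on the right. The bound \<open>I\<close> turns the
  remaining sum into one over a fixed range.\<close>

lemma Y_commutator:
  assumes "\<forall>i\<ge>I. Y u (int i) v = 0"
  shows "Y u p (Y v q w) - Y v q (Y u p w)
    = (\<Sum>i<I. sm (of_int p gchoose i) (Y (Y u (int i) v) (p + q - int i) w))"
proof -
  have "fsum (\<lambda>i. sm (of_int p gchoose i) (Y (Y u (0 + int i) v) (p + q - int i) w))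
        = fsum (\<lambda>i. sm ((-1)^i * (of_int 0 gchoose i)) (Y u (p + 0 - int i) (Y v (q + int i) w)))
          - fsum (\<lambda>i. sm ((-1)^i * (-1) powi 0 * (of_int 0 gchoose i))
                         (Y v (q + 0 - int i) (Y u (p + int i) w)))"
    using va unfolding is_vertex_algebra_def by blast
  moreover have "(0::complex) gchoose i = 0" if "i \<ge> 1" for i
    using that by (simp add: gbinomial_0_left)
  moreover have "fsum (\<lambda>i. sm (of_int p gchoose i) (Y (Y u (0 + int i) v) (p + q - int i) w))
     = (\<Sum>i<I. sm (of_int p gchoose i) (Y (Y u (0 + int i) v) (p + q - int i) w))"
    by (rule fsum_eq_sum_lessThan) (simp add: assms lin_zero[OF Y_lin_left])
  ultimately show ?thesis
    by (simp add: fsum_eq_sum_lessThan[where I = 1])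
qed

text \<open>Res_y G(y) Y(u,y) v.\<close>
definition mode :: "complex fls \<Rightarrow> 'v \<Rightarrow> 'v \<Rightarrow> 'v" where
  "mode G u v = (\<Sum>j\<in>{j. Y u j v \<noteq> 0 \<and> G $$ j \<noteq> 0}. sm (G $$ j) (Y u j v))"

text \<open>The summation range in the definition depends on all arguments. A common interval lets
  several modes be added term by term.\<close>

lemma mode_eq_sum:
  assumes "ord_ge I G" "\<And>j. j \<ge> J \<Longrightarrow> Y u j v = 0"
  shows "mode G u v = (\<Sum>j\<in>{I..<J}. sm (G $$ j) (Y u j v))"
  unfolding mode_def
proof (rule sum.mono_neutral_left)
  show "{j. Y u j v \<noteq> 0 \<and> G $$ j \<noteq> 0} \<subseteq> {I..<J}"
  proof
    fix j assume j: "j \<in> {j. Y u j v \<noteq> 0 \<and> G $$ j \<noteq> 0}"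
    then have "\<not> j < I" using ord_geD[OF assms(1), of j] by auto
    moreover have "\<not> J \<le> j" using assms(2)[of j] j by auto
    ultimately show "j \<in> {I..<J}" by auto
  qed
qed auto

lemma mode_high: "ord_ge J G \<Longrightarrow> (\<And>j. j \<ge> J \<Longrightarrow> Y u j v = 0) \<Longrightarrow> mode G u v = 0"
  by (subst mode_eq_sum[of J G J]) auto

lemma mode_high_ex: "\<exists>K. \<forall>G. ord_ge K G \<longrightarrow> mode G u v = 0"
  using Y_truncation[of u v] by (metis mode_high)

lemma mode_X_powi: "mode (fls_X powi q) u v = Y u q v"
proof -
  obtain J where J: "\<And>j. j \<ge> J \<Longrightarrow> Y u j v = 0" using Y_truncation by blast
  have "mode (fls_X powi q) u v = (\<Sum>j\<in>{q..<max (q+1) J}. sm (fls_X powi q $$ j) (Y u j v))"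
    by (rule mode_eq_sum) (auto simp: ord_ge_def J)
  also have "\<dots> = (\<Sum>j\<in>{q}. sm (fls_X powi q $$ j) (Y u j v))"
    by (rule sum.mono_neutral_right) auto
  finally show ?thesis by simp
qed

lemma mode_add: "mode (G + H) u v = mode G u v + mode H u v"
proof -
  obtain J where J: "\<And>j. j \<ge> J \<Longrightarrow> Y u j v = 0" using Y_truncation by blast
  define I where "I = min (fls_subdegree G) (fls_subdegree H)"
  have "ord_ge I G" "ord_ge I H" "ord_ge I (G + H)"
    by (auto simp: ord_ge_def I_def)
  then show ?thesis
    by (simp add: mode_eq_sum[OF _ J] scale_left_distrib sum.distrib)
qed

lemma mode_const_mult: "mode (fls_const c * G) u v = sm c (mode G u v)"
proof -
  obtain J where J: "\<And>j. j \<ge> J \<Longrightarrow> Y u j v = 0" using Y_truncation by blast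
  have "ord_ge (fls_subdegree G) G" "ord_ge (fls_subdegree G) (fls_const c * G)"
    by (auto simp: ord_ge_def)
  then show ?thesis
    by (simp add: mode_eq_sum[OF _ J] scale_sum_right)
qed

lemma mode_lin: "lin (mode G u)"
proof (rule linI)
  fix v w
  obtain J K where J: "\<And>j. j \<ge> J \<Longrightarrow> Y u j v = 0" and K: "\<And>j. j \<ge> K \<Longrightarrow> Y u j w = 0"
    using Y_truncation by metis
  have "mode G u x = (\<Sum>j\<in>{fls_subdegree G..<max J K}. sm (G $$ j) (Y u j x))"
    if "x \<in> {v, w, v + w}" for x
    by (rule mode_eq_sum[OF ord_ge_subdegree]) (use that in \<open>auto simp: J K lin_add[OF Y_lin]\<close>)
  then show "mode G u (v + w) = mode G u v + mode G u w"
    by (simp add: lin_add[OF Y_lin] scale_right_distrib sum.distrib)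
next
  fix c v
  obtain J where J: "\<And>j. j \<ge> J \<Longrightarrow> Y u j v = 0" using Y_truncation by metis
  have "mode G u x = (\<Sum>j\<in>{fls_subdegree G..<J}. sm (G $$ j) (Y u j x))"
    if "x \<in> {v, sm c v}" for x
    by (rule mode_eq_sum[OF ord_ge_subdegree]) (use that in \<open>auto simp: J lin_scale[OF Y_lin]\<close>)
  then show "mode G u (sm c v) = sm c (mode G u v)"
    by (simp add: lin_scale[OF Y_lin] scale_sum_right mult.commute)
qed

lemma mode_lin_left: "lin (\<lambda>u. mode G u v)"
proof (rule linI)
  fix u w
  obtain J K where J: "\<And>j. j \<ge> J \<Longrightarrow> Y u j v = 0" and K: "\<And>j. j \<ge> K \<Longrightarrow> Y w j v = 0"
    using Y_truncation by metis
  have "mode G x v = (\<Sum>j\<in>{fls_subdegree G..<max J K}. sm (G $$ j) (Y x j v))"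
    if "x \<in> {u, w, u + w}" for x
    by (rule mode_eq_sum[OF ord_ge_subdegree]) (use that in \<open>auto simp: J K lin_add[OF Y_lin_left]\<close>)
  then show "mode G (u + w) v = mode G u v + mode G w v"
    by (simp add: lin_add[OF Y_lin_left] scale_right_distrib sum.distrib)
next
  fix c u
  obtain J where J: "\<And>j. j \<ge> J \<Longrightarrow> Y u j v = 0" using Y_truncation by metis
  have "mode G x v = (\<Sum>j\<in>{fls_subdegree G..<J}. sm (G $$ j) (Y x j v))"
    if "x \<in> {u, sm c u}" for x
    by (rule mode_eq_sum[OF ord_ge_subdegree]) (use that in \<open>auto simp: J lin_scale[OF Y_lin_left]\<close>)
  then show "mode G (sm c u) v = sm c (mode G u v)"
    by (simp add: lin_scale[OF Y_lin_left] scale_sum_right mult.commute)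
qed

text \<open>Such maps are determined by their values on one series of each order.\<close>
definition cont :: "(complex fls \<Rightarrow> 'v) \<Rightarrow> bool" where
  "cont A \<longleftrightarrow> (\<forall>G H. A (G + H) = A G + A H) \<and> (\<forall>c G. A (fls_const c * G) = sm c (A G))
     \<and> (\<exists>K. \<forall>G. ord_ge K G \<longrightarrow> A G = 0)"

lemma cont_add: "cont A \<Longrightarrow> A (G + H) = A G + A H"
  and cont_const_mult: "cont A \<Longrightarrow> A (fls_const c * G) = sm c (A G)"
  and cont_bound: "cont A \<Longrightarrow> \<exists>K. \<forall>G. ord_ge K G \<longrightarrow> A G = 0"
  by (simp_all add: cont_def)

lemma contI:
  assumes "\<And>G H. A (G + H) = A G + A H" "\<And>c G. A (fls_const c * G) = sm c (A G)"
    "\<And>G. ord_ge K G \<Longrightarrow> A G = 0"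
  shows "cont A"
  using assms by (auto simp: cont_def)

text \<open>Subtracting the leading coefficient times \<open>F d\<close> raises the order by one, so
  after finitely many steps the remainder lies where both maps vanish; no limit is involved.\<close>

lemma cont_eqI:
  assumes A: "cont A" and B: "cont B"
    and F: "\<And>d. ord_ge d (F d)" "\<And>d. F d $$ d = 1" "\<And>d. A (F d) = B (F d)"
  shows "A G = B G"
proof -
  obtain K L where K: "\<And>G. ord_ge K G \<Longrightarrow> A G = 0" and L: "\<And>G. ord_ge L G \<Longrightarrow> B G = 0"
    using cont_bound[OF A] cont_bound[OF B] by blast
  \<comment> \<open>\<open>n\<close> bounds the number of subtractions still needed to reach order
    \<open>max K L\<close>.\<close>
  have *: "A G = B G" if "ord_ge d G" "max K L - d \<le> int n" for n d G
    using that
  proof (induction n arbitrary: d G)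
    case 0
    then have "ord_ge K G" "ord_ge L G" by (auto intro: ord_ge_mono)
    then show ?case by (simp add: K L)
  next
    case (Suc n)
    define H where "H = G + fls_const (- G $$ d) * F d"
    have "ord_ge (d + 1) H"
      unfolding ord_ge_def
    proof (intro allI impI)
      fix j assume "j < d + 1"
      then consider "j < d" | "j = d" by linarith
      then show "H $$ j = 0"
        by cases (use Suc.prems F(1)[of d] F(2)[of d] in \<open>auto simp: H_def ord_ge_def\<close>)
    qed
    moreover have "max K L - (d + 1) \<le> int n" using Suc.prems(2) by linarith
    ultimately have "A H = B H" by (rule Suc.IH)
    then show ?case
      by (simp only: H_def cont_add[OF A] cont_add[OF B] cont_const_mult[OF A] cont_const_mult[OF B] F(3)) simp
  qed
  show ?thesis
    by (rule *[OF ord_ge_subdegree, of _ "nat (max K L - fls_subdegree G)"]) linarith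
qed

lemma cont_eqI_X:
  assumes "cont A" "cont B" "\<And>d. A (fls_X powi d) = B (fls_X powi d)"
  shows "A G = B G"
  by (rule cont_eqI[where F = "\<lambda>d. fls_X powi d"]) (use assms in \<open>auto simp: ord_ge_def\<close>)

lemma cont_mode: "cont (\<lambda>G. mode G u v)"
  using mode_high_ex by (auto simp: cont_def mode_add mode_const_mult)

lemma cont_plus:
  assumes "cont A" "cont B"
  shows "cont (\<lambda>G. A G + B G)"
proof -
  obtain K L where "\<And>G. ord_ge K G \<Longrightarrow> A G = 0" and "\<And>G. ord_ge L G \<Longrightarrow> B G = 0"
    using cont_bound[OF assms(1)] cont_bound[OF assms(2)] by blast
  then have "A G + B G = 0" if "ord_ge (max K L) G" for G
    using ord_ge_mono[OF that, of K] ord_ge_mono[OF that, of L] by simp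
  then show ?thesis
    by (intro contI[where K = "max K L"])
       (simp_all add: cont_add[OF assms(1)] cont_add[OF assms(2)] cont_const_mult[OF assms(1)]
         cont_const_mult[OF assms(2)] scale_right_distrib)
qed

lemma cont_lin: "lin f \<Longrightarrow> cont A \<Longrightarrow> cont (\<lambda>G. f (A G))"
  unfolding cont_def by (auto simp: lin_add lin_scale lin_zero) (metis lin_zero)

lemma cont_zero: "cont (\<lambda>G. 0)"
  by (simp add: cont_def)

lemma cont_sum: "(\<And>a. a \<in> S \<Longrightarrow> cont (A a)) \<Longrightarrow> cont (\<lambda>G. \<Sum>a\<in>S. A a G)"
  by (induction S rule: infinite_finite_induct) (auto intro: cont_zero cont_plus)

lemma cont_scaled: "cont A \<Longrightarrow> cont (\<lambda>G. sm c (A G))"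
  by (rule cont_lin[OF lin_scaled[OF lin_id]])

lemma cont_minus:
  assumes "cont A" "cont B"
  shows "cont (\<lambda>G. A G - B G)"
  using cont_plus[OF assms(1) cont_scaled[OF assms(2), of "-1"]]
  by (simp add: scale_minus_left)

text \<open>A map \<open>f\<close> that lowers the order by at most \<open>d\<close> only moves the
  vanishing threshold from \<open>K\<close> to \<open>K + d\<close>; \<open>d\<close> may be
  negative.\<close>

lemma cont_subst:
  assumes "cont A" "\<And>G H. f (G + H) = f G + f H" "\<And>c G. f (fls_const c * G) = fls_const c * f G"
    and "\<And>K G. ord_ge K G \<Longrightarrow> ord_ge (K - d) (f G)"
  shows "cont (\<lambda>G. A (f G))"
proof -
  obtain K where "\<And>G. ord_ge K G \<Longrightarrow> A G = 0"
    using cont_bound[OF assms(1)] by blast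
  then show ?thesis
    using assms(4)[of "K + d"]
    by (intro contI[where K = "K + d"])
       (simp_all add: assms(2,3) cont_add[OF assms(1)] cont_const_mult[OF assms(1)])
qed

lemma cont_mult: "cont A \<Longrightarrow> cont (\<lambda>G. A (H * G))"
proof (rule cont_subst[where d = "- fls_subdegree H"])
  show "ord_ge (K - (- fls_subdegree H)) (H * G)" if "ord_ge K G" for K and G :: "complex fls"
    using ord_ge_mult[OF ord_ge_subdegree that, of H] by (simp add: add.commute)
qed (simp_all add: algebra_simps)

lemma cont_mult_right: "cont A \<Longrightarrow> cont (\<lambda>G. A (G * H))"
  using cont_mult[of A H] by (simp add: mult.commute)

lemma cont_deriv: "cont A \<Longrightarrow> cont (\<lambda>G. A (fls_deriv G))"
  by (rule cont_subst[where d = 1])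
     (simp_all add: ord_ge_deriv fls_deriv_mult_const_left del: fls_deriv_mult)

lemma cont_hderiv: "cont A \<Longrightarrow> cont (\<lambda>G. A (fls_hderiv i G))"
  by (rule cont_subst[where d = "int i"])
     (simp_all add: ord_ge_hderiv fls_hderiv_add fls_hderiv_const_mult)

text \<open>For monomials this is \<open>Y_commutator\<close>, the binomial coefficient being that
  of the Hasse derivative of y^p. Both sides are \<open>cont\<close> in each series separately,
  which extends it first in \<open>G\<close> and then in \<open>H\<close>.\<close>

lemma mode_commutator:
  assumes I: "\<forall>i\<ge>I. Y u (int i) v = 0"
  shows "mode H u (mode G v w) - mode G v (mode H u w)
    = (\<Sum>i<I. mode (fls_hderiv i H * G) (Y u (int i) v) w)"
proof -
  have 1: "Y u p (mode G v w) - mode G v (Y u p w)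
    = (\<Sum>i<I. mode (fls_hderiv i (fls_X powi p) * G) (Y u (int i) v) w)" for p G
  proof (rule cont_eqI_X)
    show "cont (\<lambda>G. Y u p (mode G v w) - mode G v (Y u p w))"
      by (intro cont_minus cont_mode cont_lin[OF Y_lin])
    show "cont (\<lambda>G. \<Sum>i<I. mode (fls_hderiv i (fls_X powi p) * G) (Y u (int i) v) w)"
      by (intro cont_sum cont_mult cont_mode)
    fix q
    have "fls_hderiv i (fls_X powi p) * fls_X powi q
      = fls_const (of_int p gchoose i) * (fls_X powi (p + q - int i) :: complex fls)" for i
      unfolding fls_hderiv_X_powi mult.assoc
      by (subst power_int_add[symmetric]) (auto simp: algebra_simps)
    then show "Y u p (mode (fls_X powi q) v w) - mode (fls_X powi q) v (Y u p w)
      = (\<Sum>i<I. mode (fls_hderiv i (fls_X powi p) * fls_X powi q) (Y u (int i) v) w)"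
      by (simp only: mode_X_powi mode_const_mult Y_commutator[OF I])
  qed
  show ?thesis
  proof (rule cont_eqI_X[of "\<lambda>H. mode H u (mode G v w) - mode G v (mode H u w)"])
    show "cont (\<lambda>H. mode H u (mode G v w) - mode G v (mode H u w))"
      by (intro cont_minus cont_mode cont_lin[OF mode_lin])
    show "cont (\<lambda>H. \<Sum>i<I. mode (fls_hderiv i H * G) (Y u (int i) v) w)"
      by (intro cont_sum cont_hderiv[where A = "\<lambda>H. mode (H * G) _ w"] cont_mult_right cont_mode)
    fix p
    show "mode (fls_X powi p) u (mode G v w) - mode G v (mode (fls_X powi p) u w)
      = (\<Sum>i<I. mode (fls_hderiv i (fls_X powi p) * G) (Y u (int i) v) w)"
      using 1[of p G] by (simp only: mode_X_powi)
  qed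
qed

abbreviation "L m \<equiv> Vir Y om m"

lemma Y_translate: "Y (L (-1) u) n v = sm (- of_int n) (Y u (n - 1) v)"
proof -
  have "Y (L (-1) u) n = sm (- of_int n) \<circ> Y u (n - 1)"
    using voa unfolding is_VOA_def by blast
  then show ?thesis by simp
qed

lemma L_lin: "lin (L m)"
  by (simp add: Vir_def Y_lin)

text \<open>Integration by parts under the residue.\<close>

lemma mode_translate: "mode G (L (-1) u) v = - mode (fls_deriv G) u v"
proof -
  have "mode G (L (-1) u) v = sm (-1) (mode (fls_deriv G) u v)"
  proof (rule cont_eqI_X[of "\<lambda>G. mode G (L (-1) u) v" "\<lambda>G. sm (-1) (mode (fls_deriv G) u v)"])
    show "cont (\<lambda>G. mode G (L (-1) u) v)" by (rule cont_mode)
    show "cont (\<lambda>G. sm (-1) (mode (fls_deriv G) u v))"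
      by (intro cont_scaled cont_deriv[where A = "\<lambda>G. mode G u v"] cont_mode)
    fix d
    have "fls_deriv (fls_X powi d :: complex fls) = fls_const (of_int d) * fls_X powi (d - 1)"
      using fls_hderiv_X_powi[of "Suc 0" d, where 'a = complex] by (simp only: fls_hderiv_1) simp
    then show "mode (fls_X powi d) (L (-1) u) v = sm (-1) (mode (fls_deriv (fls_X powi d)) u v)"
      by (simp only: mode_X_powi mode_const_mult Y_translate scale_scale mult_minus1)
  qed
  then show ?thesis by (simp add: scale_minus_left)
qed

section \<open>The weight grading\<close>

abbreviation "V k \<equiv> Vwt sm Y om k"
abbreviation "wc k \<equiv> wcomp sm Y om k"

lemma V_iff: "v \<in> V k \<longleftrightarrow> L 0 v = sm (of_int k) v"
  by (simp add: Vwt_def)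

lemma V_zero [simp]: "0 \<in> V k"
  by (simp add: V_iff lin_zero[OF L_lin])

lemma V_add: "v \<in> V k \<Longrightarrow> w \<in> V k \<Longrightarrow> v + w \<in> V k"
  by (simp add: V_iff lin_add[OF L_lin] scale_right_distrib)

lemma V_scale: "v \<in> V k \<Longrightarrow> sm c v \<in> V k"
  by (simp add: V_iff lin_scale[OF L_lin] mult.commute)

lemma V_diff: "v \<in> V k \<Longrightarrow> w \<in> V k \<Longrightarrow> v - w \<in> V k"
  by (simp add: V_iff lin_diff[OF L_lin] scale_right_diff_distrib)

text \<open>Applying L(0) - i removes the component of weight i and multiplies the others by the
  nonzero numbers k - i, so induction applies.\<close>

lemma V_independent:
  assumes "finite S" "\<And>k. k \<in> S \<Longrightarrow> f k \<in> V k" "(\<Sum>k\<in>S. f k) = 0" "j \<in> S"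
  shows "f j = 0"
  using assms
proof (induction S arbitrary: f j)
  case (insert i S)
  have "(\<Sum>k\<in>S. sm (of_int (k - i)) (f k)) = 0"
  proof -
    have "(\<Sum>k\<in>S. sm (of_int (k - i)) (f k)) = (\<Sum>k\<in>insert i S. sm (of_int (k - i)) (f k))"
      using insert.hyps by simp
    also have "\<dots> = (\<Sum>k\<in>insert i S. L 0 (f k) - sm (of_int i) (f k))"
      using insert.prems(1) by (intro sum.cong refl) (simp add: V_iff scale_left_diff_distrib)
    also have "\<dots> = L 0 (\<Sum>k\<in>insert i S. f k) - sm (of_int i) (\<Sum>k\<in>insert i S. f k)"
      by (simp only: sum_subtractf lin_sum[OF L_lin] scale_sum_right)
    finally show ?thesis using insert.prems(2) by (simp add: lin_zero[OF L_lin])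
  qed
  then have "sm (of_int (k - i)) (f k) = 0" if "k \<in> S" for k
    by (rule insert.IH[of "\<lambda>k. sm (of_int (k - i)) (f k)", rotated])
       (use insert.prems that in \<open>auto intro: V_scale\<close>)
  then have *: "f k = 0" if "k \<in> S" for k
    using that insert.hyps by (auto simp: scale_eq_0_iff)
  then have "f i = 0" using insert.prems(2) insert.hyps by simp
  with * show ?case using insert.prems(3) by auto
qed simp

lemma V_decomposition:
  "\<exists>S f. finite S \<and> (\<forall>k\<in>S. f k \<in> V k) \<and> v = (\<Sum>k\<in>S. f k)"
  using voa unfolding is_VOA_def by blast

text \<open>By independence any two decompositions agree in each weight, so the choice in
  \<open>wcomp\<close> has a single candidate.\<close>

lemma wc_eq:
  assumes S: "finite S" "\<And>k. k \<in> S \<Longrightarrow> f k \<in> V k" "v = (\<Sum>k\<in>S. f k)"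
  shows "wc j v = (if j \<in> S then f j else 0)"
proof -
  have *: "(if j \<in> S' then f' j else 0) = (if j \<in> S then f j else 0)"
    if S': "finite S'" "\<forall>k\<in>S'. f' k \<in> V k" "v = (\<Sum>k\<in>S'. f' k)" for S' f'
  proof -
    define d where "d k = (if k \<in> S' then f' k else 0) - (if k \<in> S then f k else 0)" for k
    have "(\<Sum>k\<in>S \<union> S'. d k) = 0"
      unfolding d_def sum_subtractf
      using S S' by (simp add: sum.inter_restrict[symmetric] Int_absorb1 Int_absorb2)
    moreover have "d k \<in> V k" for k
      unfolding d_def by (rule V_diff) (use S(2) S'(2) in auto)
    ultimately have "j \<in> S \<union> S' \<Longrightarrow> d j = 0"
      using S(1) S'(1) by (intro V_independent[of "S \<union> S'" d]) auto
    then show ?thesis by (auto simp: d_def split: if_splits)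
  qed
  show ?thesis
    unfolding wcomp_def
  proof (rule some_equality)
    show "\<exists>S' f'. finite S' \<and> (\<forall>k\<in>S'. f' k \<in> V k) \<and> v = (\<Sum>k\<in>S'. f' k)
        \<and> (if j \<in> S then f j else 0) = (if j \<in> S' then f' j else 0)"
      using S by (intro exI[of _ S] exI[of _ f]) auto
  next
    fix w
    assume "\<exists>S' f'. finite S' \<and> (\<forall>k\<in>S'. f' k \<in> V k) \<and> v = (\<Sum>k\<in>S'. f' k)
        \<and> w = (if j \<in> S' then f' j else 0)"
    then obtain S' f' where "finite S'" "\<forall>k\<in>S'. f' k \<in> V k" "v = (\<Sum>k\<in>S'. f' k)"
      and w: "w = (if j \<in> S' then f' j else 0)"
      by (elim exE conjE)
    then show "w = (if j \<in> S then f j else 0)" using * by simp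
  qed
qed

lemma wc_support: "finite {k. wc k v \<noteq> 0}"
  and wc_V: "wc k v \<in> V k"
  and wc_sum: "(\<Sum>k | wc k v \<noteq> 0. wc k v) = v"
proof -
  obtain S f where S: "finite S" "\<And>k. k \<in> S \<Longrightarrow> f k \<in> V k" "v = (\<Sum>k\<in>S. f k)"
    using V_decomposition[of v] by blast
  note eq = wc_eq[OF S]
  show "wc k v \<in> V k" using S(2) by (simp add: eq)
  have sub: "{k. wc k v \<noteq> 0} \<subseteq> S" by (auto simp: eq)
  then show "finite {k. wc k v \<noteq> 0}" using S(1) finite_subset by blast
  have "(\<Sum>k | wc k v \<noteq> 0. wc k v) = (\<Sum>k\<in>S. wc k v)"
    by (rule sum.mono_neutral_left) (use S(1) sub in auto)
  also have "\<dots> = (\<Sum>k\<in>S. f k)" by (intro sum.cong refl) (simp add: eq)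
  also have "\<dots> = v" using S(3) by simp
  finally show "(\<Sum>k | wc k v \<noteq> 0. wc k v) = v" .
qed

lemma wc_sum_superset:
  assumes "finite S" "{k. wc k v \<noteq> 0} \<subseteq> S"
  shows "(\<Sum>k\<in>S. wc k v) = v"
proof -
  have "(\<Sum>k\<in>S. wc k v) = (\<Sum>k | wc k v \<noteq> 0. wc k v)"
    by (rule sum.mono_neutral_right) (use assms in auto)
  then show ?thesis by (simp add: wc_sum)
qed

lemma wc_homogeneous: "v \<in> V j \<Longrightarrow> wc k v = (if k = j then v else 0)"
  using wc_eq[of "{j}" "\<lambda>_. v" v k] by simp

lemma wc_lin: "lin (wc k)"
proof (rule linI)
  fix v w
  let ?S = "{k. wc k v \<noteq> 0} \<union> {k. wc k w \<noteq> 0}"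
  have "v = (\<Sum>k\<in>?S. wc k v)"
    by (rule wc_sum_superset[symmetric]) (auto simp: wc_support)
  moreover have "w = (\<Sum>k\<in>?S. wc k w)"
    by (rule wc_sum_superset[symmetric]) (auto simp: wc_support)
  ultimately have "v + w = (\<Sum>k\<in>?S. wc k v + wc k w)"
    by (simp add: sum.distrib)
  then show "wc k (v + w) = wc k v + wc k w"
    by (subst wc_eq[of ?S "\<lambda>k. wc k v + wc k w"]) (auto simp: wc_support wc_V V_add)
next
  fix c v
  have "sm c v = (\<Sum>k | wc k v \<noteq> 0. sm c (wc k v))"
    by (simp only: wc_sum flip: scale_sum_right)
  then show "wc k (sm c v) = sm c (wc k v)"
    by (subst wc_eq[of "{k. wc k v \<noteq> 0}" "\<lambda>k. sm c (wc k v)"]) (auto simp: wc_support wc_V V_scale)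
qed

lemma lin_eq_homogeneous:
  assumes "lin f" "lin g" "\<And>k v. v \<in> V k \<Longrightarrow> f v = g v"
  shows "f v = g v"
proof -
  have "f v = (\<Sum>k | wc k v \<noteq> 0. f (wc k v))"
    by (simp only: wc_sum flip: lin_sum[OF assms(1)])
  also have "\<dots> = (\<Sum>k | wc k v \<noteq> 0. g (wc k v))"
    by (simp add: assms(3)[OF wc_V])
  also have "\<dots> = g v"
    by (simp only: wc_sum flip: lin_sum[OF assms(2)])
  finally show ?thesis .
qed

text \<open>Commute with om_1 = L(0): since \<open>1 gchoose i\<close> vanishes for i >= 2, only
  L(-1) u and L(0) u contribute, giving -(n+1) and k.\<close>

lemma Y_weight:
  assumes u: "u \<in> V k" and v: "v \<in> V l"
  shows "Y u n v \<in> V (k + l - n - 1)"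
proof -
  obtain I where I: "\<forall>i\<ge>I. Y om (int i) u = 0" using Y_truncation_nat by blast
  \<comment> \<open>The bound is enlarged so that the indices 0 and 1 certainly lie in the
    range.\<close>
  then have I': "\<forall>i\<ge>I + 2. Y om (int i) u = 0" by simp
  have "Y om 1 (Y u n v) - Y u n (Y om 1 v)
     = (\<Sum>i<I+2. sm (of_int 1 gchoose i) (Y (Y om (int i) u) (1 + n - int i) v))"
    by (rule Y_commutator[OF I'])
  also have "\<dots> = (\<Sum>i\<in>{0,1}. sm (of_int 1 gchoose i) (Y (Y om (int i) u) (1 + n - int i) v))"
  proof (rule sum.mono_neutral_right)
    have "(1 :: complex) gchoose i = 0" if "i \<ge> 2" for i
      using that binomial_gbinomial[of 1 i, where 'a = complex] by (simp add: binomial_eq_0)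
    then show "\<forall>i\<in>{..<I+2} - {0,1}. sm (of_int 1 gchoose i) (Y (Y om (int i) u) (1 + n - int i) v) = 0"
      by (auto simp: not_less less_2_cases_iff)
  qed auto
  also have "\<dots> = Y (L (-1) u) (n + 1) v + Y (L 0 u) n v"
    by (simp add: Vir_def add.commute)
  also have "\<dots> = sm (of_int (k - n - 1)) (Y u n v)"
    using u by (simp add: Y_translate V_iff lin_scale[OF Y_lin_left] scale_left_distrib[symmetric])
  finally have "L 0 (Y u n v) = Y u n (L 0 v) + sm (of_int (k - n - 1)) (Y u n v)"
    by (simp add: Vir_def algebra_simps)
  also have "Y u n (L 0 v) = sm (of_int l) (Y u n v)"
    using v by (simp add: V_iff lin_scale[OF Y_lin])
  also have "sm (of_int l) (Y u n v) + sm (of_int (k - n - 1)) (Y u n v)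
      = sm (of_int (k + l - n - 1)) (Y u n v)"
    by (subst scale_left_distrib[symmetric]) (simp add: add.commute)
  finally show ?thesis by (simp add: V_iff)
qed

lemma om_V: "om \<in> V 2"
  using voa by (simp add: is_VOA_def)

text \<open>L[0] and \<open>Phi\<close> mix weights and need not preserve the spaces
  \<open>V k\<close>, but they respect this increasing filtration by top weight; on the quotient of
  \<open>W k\<close> by \<open>W (k - 1)\<close> they act as the scalar k and as the
  identity.\<close>

definition W :: "int \<Rightarrow> 'v set" where
  "W k = {v. \<forall>j>k. wc j v = 0}"

lemma W_D: "v \<in> W k \<Longrightarrow> k < j \<Longrightarrow> wc j v = 0"
  by (simp add: W_def)

lemma W_zero [simp]: "0 \<in> W k"
  by (simp add: W_def lin_zero[OF wc_lin])

lemma W_add: "v \<in> W k \<Longrightarrow> w \<in> W k \<Longrightarrow> v + w \<in> W k"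
  by (simp add: W_def lin_add[OF wc_lin])

lemma W_diff: "v \<in> W k \<Longrightarrow> w \<in> W k \<Longrightarrow> v - w \<in> W k"
  by (simp add: W_def lin_diff[OF wc_lin])

lemma W_scale: "v \<in> W k \<Longrightarrow> sm c v \<in> W k"
  by (simp add: W_def lin_scale[OF wc_lin])

lemma W_sum: "(\<And>a. a \<in> A \<Longrightarrow> f a \<in> W k) \<Longrightarrow> sum f A \<in> W k"
  by (simp add: W_def lin_sum[OF wc_lin])

lemma W_mono: "v \<in> W k \<Longrightarrow> k \<le> l \<Longrightarrow> v \<in> W l"
  by (simp add: W_def)

lemma V_W: "v \<in> V j \<Longrightarrow> j \<le> k \<Longrightarrow> v \<in> W k"
  by (simp add: W_def wc_homogeneous)

lemma W_step: "v \<in> W k \<Longrightarrow> wc k v = 0 \<Longrightarrow> v \<in> W (k - 1)"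
  unfolding W_def
proof clarify
  fix j assume "\<forall>j>k. wc j v = 0" "wc k v = 0" "k - 1 < j"
  then show "wc j v = 0" by (cases "j = k") auto
qed

lemma W_split: "v \<in> W k \<Longrightarrow> v - wc k v \<in> W (k - 1)"
  by (rule W_step) (auto simp: lin_diff[OF wc_lin] wc_homogeneous[OF wc_V] intro!: W_diff V_W[OF wc_V])

lemma W_ex: "\<exists>k. v \<in> W k"
proof -
  have "bdd_above {k. wc k v \<noteq> 0}"
    using wc_support by (rule bdd_above_finite)
  then obtain k where k: "\<forall>j\<in>{k. wc k v \<noteq> 0}. j \<le> k"
    unfolding bdd_above_def by blast
  have "wc j v = 0" if "k < j" for j using k that by force
  then have "v \<in> W k" by (simp add: W_def)
  then show ?thesis ..
qed

lemma W_bottom: "\<exists>N. \<forall>k<N. W k = {0}"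
proof -
  obtain N where N: "\<forall>k<N. V k = {0}" using voa unfolding is_VOA_def by blast
  have "v = 0" if "v \<in> W k" "k < N" for v k
  proof -
    have "wc j v = 0" for j
      using that N wc_V[of j v] W_D[of v k j] by (cases "j < N") auto
    then show ?thesis using wc_sum[of v] by simp
  qed
  then show ?thesis by (intro exI[of _ N]) auto
qed

text \<open>Weights are bounded below, so the top weight can drop only finitely often before the
  vector is 0.\<close>

lemma W_induct:
  assumes "P 0" "\<And>k v. v \<in> W k \<Longrightarrow> (\<And>w. w \<in> W (k - 1) \<Longrightarrow> P w) \<Longrightarrow> P v"
  shows "P v"
proof -
  obtain N where N: "\<forall>k<N. W k = {0}" using W_bottom by blast
  have *: "P v" if "v \<in> W k" "k < N + int n" for k v n
    using that
  proof (induction n arbitrary: k v)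
    case 0
    then show ?case using N assms(1) by auto
  next
    case (Suc n)
    show ?case by (rule assms(2)[OF Suc.prems(1)]) (use Suc in auto)
  qed
  obtain k where "v \<in> W k" using W_ex by blast
  then show ?thesis
    by (rule *[of v k "nat (k - N) + 1"]) linarith
qed

lemma W_lin:
  assumes "lin f" "\<And>j v. v \<in> V j \<Longrightarrow> f v \<in> W (j + d)" "v \<in> W k"
  shows "f v \<in> W (k + d)"
proof -
  have "f v = (\<Sum>j | wc j v \<noteq> 0. f (wc j v))"
    by (simp only: wc_sum flip: lin_sum[OF assms(1)])
  also have "\<dots> \<in> W (k + d)"
  proof (rule W_sum)
    fix j assume "j \<in> {j. wc j v \<noteq> 0}"
    then have "j \<le> k" using W_D[OF assms(3)] by force
    then show "f (wc j v) \<in> W (k + d)"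
      using assms(2)[OF wc_V] by (rule_tac W_mono) auto
  qed
  finally show ?thesis .
qed

section \<open>The change of coordinates\<close>

text \<open>The operator L[0].\<close>
definition zhuL0 :: "'v \<Rightarrow> 'v" where
  "zhuL0 v = mode xlog om v"

lemma zhuL0_lin: "lin zhuL0"
  unfolding zhuL0_def by (rule mode_lin)

lemma zhuL0_eq_sum:
  assumes "\<forall>i\<ge>I. Y om (int i) v = 0"
  shows "zhuL0 v = (\<Sum>i<I. sm (xlog $$ int i) (Y om (int i) v))"
proof -
  have "zhuL0 v = (\<Sum>j\<in>{0..<int I}. sm (xlog $$ j) (Y om j v))"
    unfolding zhuL0_def
  proof (rule mode_eq_sum)
    show "ord_ge 0 xlog" by (simp add: ord_ge_def xlog_nth)
    fix j assume "int I \<le> j"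
    then show "Y om j v = 0" using assms[rule_format, of "nat j"] by simp
  qed
  also have "{0..<int I} = int ` {..<I}"
    using image_int_atLeastLessThan[of 0 I] by (simp add: atLeast0LessThan)
  finally show ?thesis by (simp add: sum.reindex)
qed

text \<open>The terms i = 0 and i = 1 of the expansion are 0 and L(0). The remaining om_(i+2) =
  L(i+1) lowers the weight by i + 1.\<close>

lemma zhuL0_eq:
  "\<exists>I. (\<forall>i\<ge>I. Y om (int i) v = 0) \<and>
     zhuL0 v = L 0 v + (\<Sum>i<I. sm (xlog $$ int (i + 2)) (Y om (int (i + 2)) v))"
proof -
  obtain I where "\<forall>i\<ge>I. Y om (int i) v = 0" using Y_truncation_nat by blast
  then have *: "\<forall>i\<ge>I. Y om (int i) v = 0" "\<forall>i\<ge>Suc (Suc I). Y om (int i) v = 0" by simp_all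
  have "zhuL0 v = L 0 v + (\<Sum>i<I. sm (xlog $$ int (i + 2)) (Y om (int (i + 2)) v))"
    unfolding zhuL0_eq_sum[OF *(2)] sum.lessThan_Suc_shift by (simp add: xlog_nth Vir_def)
  with * show ?thesis by blast
qed

section \<open>Modes twisted by (1+y)^L(0)\<close>

abbreviation tw :: "int \<Rightarrow> complex fls" where
  "tw k \<equiv> (1 + fls_X) powi k"

lemma tw_add: "tw j * tw k = tw (j + k)"
  by (simp add: power_int_add)

lemma tw_nth: "tw k $$ j = (if j < 0 then 0 else of_int k gchoose nat j)"
  by (simp add: one_plus_fls_X_powi_eq)

text \<open>Res_y G(y) Y((1+y)^L(0) u, y) v.\<close>
definition tmode :: "complex fls \<Rightarrow> 'v \<Rightarrow> 'v \<Rightarrow> 'v" where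
  "tmode G u v = (\<Sum>k | wc k u \<noteq> 0. mode (G * tw k) (wc k u) v)"

lemma tmode_superset:
  assumes "finite A" "{k. wc k u \<noteq> 0} \<subseteq> A"
  shows "tmode G u v = (\<Sum>k\<in>A. mode (G * tw k) (wc k u) v)"
  unfolding tmode_def
  by (rule sum.mono_neutral_left) (use assms in \<open>auto simp: lin_zero[OF mode_lin_left]\<close>)

lemma tmode_homogeneous: "u \<in> V k \<Longrightarrow> tmode G u v = mode (G * tw k) u v"
  by (subst tmode_superset[of "{k}"]) (auto simp: wc_homogeneous split: if_splits)

lemma tmode_lin: "lin (tmode G u)"
  unfolding tmode_def by (intro lin_sums mode_lin)

lemma tmode_lin_left: "lin (\<lambda>u. tmode G u v)"
proof (rule linI)
  fix u w
  let ?A = "{k. wc k u \<noteq> 0} \<union> {k. wc k w \<noteq> 0}"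
  have "tmode G x v = (\<Sum>k\<in>?A. mode (G * tw k) (wc k x) v)" if "x \<in> {u, w, u + w}" for x
    by (rule tmode_superset) (use that in \<open>auto simp: wc_support lin_add[OF wc_lin]\<close>)
  then show "tmode G (u + w) v = tmode G u v + tmode G w v"
    by (simp add: lin_add[OF wc_lin] lin_add[OF mode_lin_left] sum.distrib)
next
  fix c u
  have "tmode G x v = (\<Sum>k | wc k u \<noteq> 0. mode (G * tw k) (wc k x) v)" if "x \<in> {u, sm c u}" for x
    by (rule tmode_superset) (use that in \<open>auto simp: wc_support lin_scale[OF wc_lin]\<close>)
  then show "tmode G (sm c u) v = sm c (tmode G u v)"
    by (simp add: lin_scale[OF wc_lin] lin_scale[OF mode_lin_left] scale_sum_right)
qed

lemma cont_tmode: "cont (\<lambda>G. tmode G u v)"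
  unfolding tmode_def by (intro cont_sum cont_mult_right[where A = "\<lambda>G. mode G _ v"] cont_mode)

text \<open>Differentiating (1+y)^k produces the term with k log(1+y), because \<open>xlog\<close>
  divided by 1+y is \<open>lg\<close>. It is isolated because it must cancel in the commutator with
  L[0].\<close>

lemma deriv_twisted:
  "fls_deriv (xlog * (G * tw k)) = fls_const (of_int k) * (lg * (G * tw k)) + fls_deriv (G * xlog) * tw k"
proof -
  have "fls_deriv (tw k) = fls_const (of_int k) * tw (k - 1)"
    by (simp add: fls_deriv_power_int fls_of_int)
  moreover have "xlog * tw (k - 1) = lg * tw k"
    by (simp add: xlog_def power_int_diff)
  moreover have "fls_deriv (xlog * (G * tw k)) = G * (xlog * fls_deriv (tw k)) + fls_deriv (G * xlog) * tw k"
    by (simp add: algebra_simps)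
  ultimately show ?thesis by (simp add: mult_ac)
qed

text \<open>Use \<open>mode_commutator\<close> with \<open>H = xlog\<close>. The i = 0 term contains
  L(-1) u and is integrated by parts; its \<open>lg\<close> part cancels against the one from i = 1,
  where the derivative of \<open>xlog\<close> is 1 + \<open>lg\<close>. What is left of i = 1,
  together with all i >= 2, assembles to the \<open>zhuL0 u\<close> term. The last term is the Lie
  derivative of G dy along x d/dx.\<close>

lemma tmode_derivation:
  "zhuL0 (tmode G u v) = tmode G u (zhuL0 v) + tmode G (zhuL0 u) v - tmode (fls_deriv (G * xlog)) u v"
proof (rule lin_eq_homogeneous[of "\<lambda>u. zhuL0 (tmode G u v)"
    "\<lambda>u. tmode G u (zhuL0 v) + tmode G (zhuL0 u) v - tmode (fls_deriv (G * xlog)) u v"])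
  show "lin (\<lambda>u. zhuL0 (tmode G u v))"
    by (rule lin_comp[OF zhuL0_lin tmode_lin_left])
  show "lin (\<lambda>u. tmode G u (zhuL0 v) + tmode G (zhuL0 u) v - tmode (fls_deriv (G * xlog)) u v)"
    by (intro lin_sub lin_plus tmode_lin_left lin_comp[OF tmode_lin_left zhuL0_lin])
  fix k u assume u: "u \<in> V k"
  obtain I where I: "\<forall>i\<ge>I. Y om (int i) u = 0"
    and L0u: "zhuL0 u = L 0 u + (\<Sum>i<I. sm (xlog $$ int (i + 2)) (Y om (int (i + 2)) u))"
    using zhuL0_eq by blast
  have I': "\<forall>i\<ge>Suc (Suc I). Y om (int i) u = 0" using I by simp
  define R where "R = (\<Sum>i<I. sm (xlog $$ int (i + 2)) (tmode G (Y om (int (i + 2)) u) v))"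
  have t0: "mode (fls_hderiv 0 xlog * (G * tw k)) (Y om (int 0) u) v
      = - mode (fls_deriv (xlog * (G * tw k))) u v"
    using mode_translate[of "xlog * (G * tw k)" u v] by (simp add: Vir_def)
  have t1: "mode (fls_hderiv (Suc 0) xlog * (G * tw k)) (Y om (int (Suc 0)) u) v
      = sm (of_int k) (mode (G * tw k) u v) + sm (of_int k) (mode (lg * (G * tw k)) u v)"
  proof -
    have "Y om (int (Suc 0)) u = sm (of_int k) u" using u by (simp add: V_iff Vir_def)
    moreover have "fls_hderiv (Suc 0) xlog * (G * tw k) = G * tw k + lg * (G * tw k)"
      using xlog_hderiv_1 by (simp add: distrib_right)
    ultimately show ?thesis
      by (simp add: mode_add lin_scale[OF mode_lin_left] scale_right_distrib)
  qed
  \<comment> \<open>By \<open>xlog_hderiv\<close> the factor \<open>tw k\<close> becomes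
    \<open>tw (k - (i + 2) + 1)\<close>, the twist belonging to the weight of om_(i+2) u.\<close>
  have t2: "mode (fls_hderiv (Suc (Suc i)) xlog * (G * tw k)) (Y om (int (Suc (Suc i))) u) v
      = sm (xlog $$ int (i + 2)) (tmode G (Y om (int (i + 2)) u) v)" for i
  proof -
    have "fls_hderiv (i + 2) xlog * (G * tw k)
        = fls_const (xlog $$ int (i + 2)) * (tw (1 - int (i + 2)) * (G * tw k))"
      by (subst xlog_hderiv) (simp_all add: mult.assoc)
    also have "tw (1 - int (i + 2)) * (G * tw k) = G * (tw (1 - int (i + 2)) * tw k)"
      by (simp only: mult_ac)
    also have "\<dots> = G * tw (k - int (i + 2) + 1)"
      unfolding tw_add by (simp add: algebra_simps)
    finally have *: "fls_hderiv (i + 2) xlog * (G * tw k)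
        = fls_const (xlog $$ int (i + 2)) * (G * tw (k - int (i + 2) + 1))" .
    have e: "Suc (Suc i) = i + 2" by simp
    have "Y om (int (i + 2)) u \<in> V (k - int (i + 2) + 1)"
      using Y_weight[OF om_V u, of "int (i + 2)"] by (simp add: algebra_simps)
    from tmode_homogeneous[OF this, of G v] show ?thesis
      unfolding e * mode_const_mult by (rule arg_cong[OF sym])
  qed
  have "zhuL0 (tmode G u v) - tmode G u (zhuL0 v)
      = (\<Sum>i<Suc (Suc I). mode (fls_hderiv i xlog * (G * tw k)) (Y om (int i) u) v)"
    unfolding tmode_homogeneous[OF u] zhuL0_def by (rule mode_commutator[OF I'])
  also have "\<dots> = - mode (fls_deriv (xlog * (G * tw k))) u v
      + (sm (of_int k) (mode (G * tw k) u v) + sm (of_int k) (mode (lg * (G * tw k)) u v) + R)"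
    unfolding sum.lessThan_Suc_shift t0 t1 t2 R_def ..
  also have "mode (fls_deriv (xlog * (G * tw k))) u v
      = sm (of_int k) (mode (lg * (G * tw k)) u v) + tmode (fls_deriv (G * xlog)) u v"
    unfolding deriv_twisted mode_add mode_const_mult tmode_homogeneous[OF u] ..
  finally have "zhuL0 (tmode G u v) - tmode G u (zhuL0 v)
      = sm (of_int k) (mode (G * tw k) u v) + R - tmode (fls_deriv (G * xlog)) u v"
    by (simp add: add_ac)
  moreover have "tmode G (zhuL0 u) v = sm (of_int k) (mode (G * tw k) u v) + R"
    unfolding L0u lin_add[OF tmode_lin_left] lin_sum[OF tmode_lin_left] lin_scale[OF tmode_lin_left] R_def
    using u by (simp add: V_iff lin_scale[OF tmode_lin_left] tmode_homogeneous[OF u])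
  ultimately show "zhuL0 (tmode G u v) = tmode G u (zhuL0 v) + tmode G (zhuL0 u) v - tmode (fls_deriv (G * xlog)) u v"
    by (simp add: diff_eq_eq add_ac)
qed

lemma zhuL0_lead_homogeneous:
  assumes v: "v \<in> V k"
  shows "zhuL0 v - sm (of_int k) v \<in> W (k - 1)"
proof -
  obtain I where "zhuL0 v = L 0 v + (\<Sum>i<I. sm (xlog $$ int (i + 2)) (Y om (int (i + 2)) v))"
    using zhuL0_eq by blast
  then have "zhuL0 v - sm (of_int k) v = (\<Sum>i<I. sm (xlog $$ int (i + 2)) (Y om (int (i + 2)) v))"
    using v by (simp add: V_iff)
  also have "\<dots> \<in> W (k - 1)"
    by (intro W_sum W_scale V_W[OF Y_weight[OF om_V v]]) simp
  finally show ?thesis .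
qed

lemma zhuL0_W: "v \<in> W k \<Longrightarrow> zhuL0 v \<in> W k"
proof -
  have "zhuL0 v \<in> W (j + 0)" if v: "v \<in> V j" for j v
    using W_add[OF W_mono[OF zhuL0_lead_homogeneous[OF v], of j] W_scale[OF V_W[OF v], of j "of_int j"]]
    by simp
  then show "v \<in> W k \<Longrightarrow> zhuL0 v \<in> W k"
    using W_lin[OF zhuL0_lin, of 0 v k] by simp
qed

lemma zhuL0_lead:
  assumes v: "v \<in> W k"
  shows "zhuL0 v - sm (of_int k) v \<in> W (k - 1)"
proof -
  define w where "w = v - wc k v"
  have w: "w \<in> W (k - 1)" unfolding w_def by (rule W_split[OF v])
  have "zhuL0 v - sm (of_int k) v
      = (zhuL0 (wc k v) - sm (of_int k) (wc k v)) + (zhuL0 w - sm (of_int k) w)"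
    by (simp add: w_def lin_diff[OF zhuL0_lin] scale_right_diff_distrib)
  then show ?thesis
    by (simp add: W_add W_diff W_scale zhuL0_W w zhuL0_lead_homogeneous[OF wc_V])
qed

text \<open>On the top component of weight j < k the operator L[0] acts as j, which differs from k;
  hence that component is 0 and the vector drops one step.\<close>

lemma zhuL0_eigen_unique: "w \<in> W (k - 1) \<Longrightarrow> zhuL0 w = sm (of_int k) w \<Longrightarrow> w = 0"
proof (induction w rule: W_induct)
  case (2 j w)
  show ?case
  proof (cases "j < k")
    case True
    have "sm (of_int (k - j)) w \<in> W (j - 1)"
      using zhuL0_lead[OF 2(1)] 2(4) by (simp add: scale_left_diff_distrib)
    then have "sm (1 / of_int (k - j)) (sm (of_int (k - j)) w) \<in> W (j - 1)"
      by (rule W_scale)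
    then have "w \<in> W (j - 1)" using True by simp
    then show ?thesis using 2 by blast
  next
    \<comment> \<open>Here \<open>k - 1 \<le> j - 1\<close>, so membership in
      \<open>W (k - 1)\<close> is already the drop by one step.\<close>
    case False
    then have "w \<in> W (j - 1)" using W_mono[OF 2(3)] by simp
    then show ?thesis using 2 by blast
  qed
qed simp

text \<open>On \<open>W (k - 1)\<close> the operator L[0] - k is triangular with diagonal entries j
  - k, all nonzero: divide by the top entry and correct the lower remainder by induction.\<close>

lemma zhuL0_solve: "y \<in> W (k - 1) \<Longrightarrow> \<exists>x\<in>W (k - 1). zhuL0 x - sm (of_int k) x = y"
proof (induction y rule: W_induct)
  case 1
  show ?case by (rule bexI[of _ 0]) (simp_all add: lin_zero[OF zhuL0_lin])
next
  case (2 j y)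
  show ?case
  proof (cases "j < k")
    case True
    \<comment> \<open>\<open>c\<close> inverts the diagonal entry; then \<open>sm c y\<close> solves
      the equation up to \<open>sm c r\<close>, whose top weight is lower.\<close>
    define c :: complex where "c = 1 / of_int (j - k)"
    define r where "r = zhuL0 y - sm (of_int j) y"
    have r: "r \<in> W (j - 1)" unfolding r_def by (rule zhuL0_lead[OF 2(1)])
    have "sm (- c) r \<in> W (j - 1)" by (rule W_scale[OF r])
    moreover have "sm (- c) r \<in> W (k - 1)" using W_mono[OF calculation] True by simp
    ultimately obtain x where x: "x \<in> W (k - 1)" "zhuL0 x - sm (of_int k) x = sm (- c) r"
      using 2(2) by blast
    have "zhuL0 (sm c y) - sm (of_int k) (sm c y) = sm c (zhuL0 y - sm (of_int k) y)"
      by (simp add: lin_scale[OF zhuL0_lin] scale_right_diff_distrib mult.commute)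
    also have "zhuL0 y - sm (of_int k) y = r + sm (of_int (j - k)) y"
      by (simp add: r_def scale_left_diff_distrib)
    also have "sm c \<dots> = sm c r + y"
      using True by (simp add: scale_right_distrib c_def)
    finally have "zhuL0 (sm c y + x) - sm (of_int k) (sm c y + x) = y"
      using x(2) by (simp add: lin_add[OF zhuL0_lin] scale_right_distrib scale_minus_left algebra_simps)
    moreover have "sm c y + x \<in> W (k - 1)" using x(1) 2(3) by (simp add: W_add W_scale)
    ultimately show ?thesis by blast
  next
    case False
    then have "y \<in> W (j - 1)" using W_mono[OF 2(3)] by simp
    then show ?thesis using 2 by blast
  qed
qed

section \<open>The bijection from L(0)-eigenvectors to L[0]-eigenvectors\<close>

definition phi :: "int \<Rightarrow> 'v \<Rightarrow> 'v" where
  "phi k u = (THE u'. zhuL0 u' = sm (of_int k) u' \<and> u' - u \<in> W (k - 1))"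

text \<open>Existence: the defect of u as an L[0]-eigenvector lies in \<open>W (k - 1)\<close>,
  where \<open>zhuL0_solve\<close> supplies the correction. Uniqueness: two candidates differ by an
  eigenvector in \<open>W (k - 1)\<close>.\<close>

lemma phi_ex1:
  assumes u: "u \<in> V k"
  shows "\<exists>!u'. zhuL0 u' = sm (of_int k) u' \<and> u' - u \<in> W (k - 1)"
proof (rule ex_ex1I)
  have "- (zhuL0 u - sm (of_int k) u) \<in> W (k - 1)"
    using W_scale[OF zhuL0_lead_homogeneous[OF u], of "-1"] by (simp add: scale_minus_left)
  then obtain x where x: "x \<in> W (k - 1)" "zhuL0 x - sm (of_int k) x = - (zhuL0 u - sm (of_int k) u)"
    using zhuL0_solve by blast
  then have "zhuL0 (u + x) = sm (of_int k) (u + x)"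
    by (simp add: lin_add[OF zhuL0_lin] scale_right_distrib diff_eq_eq)
  with x(1) show "\<exists>u'. zhuL0 u' = sm (of_int k) u' \<and> u' - u \<in> W (k - 1)"
    by (intro exI[of _ "u + x"]) simp
next
  fix a b
  assume a: "zhuL0 a = sm (of_int k) a \<and> a - u \<in> W (k - 1)"
    and b: "zhuL0 b = sm (of_int k) b \<and> b - u \<in> W (k - 1)"
  have "a - b \<in> W (k - 1)" using W_diff[OF conjunct2[OF a] conjunct2[OF b]] by simp
  moreover have "zhuL0 (a - b) = sm (of_int k) (a - b)"
    using a b by (simp add: lin_diff[OF zhuL0_lin] scale_right_diff_distrib)
  ultimately have "a - b = 0" by (rule zhuL0_eigen_unique)
  then show "a = b" by simp
qed

lemma phi_eigen: "u \<in> V k \<Longrightarrow> zhuL0 (phi k u) = sm (of_int k) (phi k u)"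
  and phi_lead: "u \<in> V k \<Longrightarrow> phi k u - u \<in> W (k - 1)"
  unfolding phi_def using theI'[OF phi_ex1] by blast+

lemma phi_eqI:
  "u \<in> V k \<Longrightarrow> zhuL0 u' = sm (of_int k) u' \<Longrightarrow> u' - u \<in> W (k - 1) \<Longrightarrow> phi k u = u'"
  unfolding phi_def using phi_ex1 by (intro the1_equality) blast+

lemma phi_add: "u \<in> V k \<Longrightarrow> v \<in> V k \<Longrightarrow> phi k (u + v) = phi k u + phi k v"
  using W_add[OF phi_lead[of u k] phi_lead[of v k]]
  by (intro phi_eqI)
     (simp_all add: V_add phi_eigen lin_add[OF zhuL0_lin] scale_right_distrib add_diff_add)

lemma phi_scale: "u \<in> V k \<Longrightarrow> phi k (sm c u) = sm c (phi k u)"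
  using W_scale[OF phi_lead[of u k], of c]
  by (intro phi_eqI)
     (simp_all add: V_scale phi_eigen lin_scale[OF zhuL0_lin] scale_right_diff_distrib mult.commute)

lemma phi_zero: "phi k 0 = 0"
  using phi_scale[of 0 k 0] by simp

definition Phi :: "'v \<Rightarrow> 'v" where
  "Phi v = (\<Sum>k | wc k v \<noteq> 0. phi k (wc k v))"

lemma Phi_superset:
  assumes "finite A" "{k. wc k u \<noteq> 0} \<subseteq> A"
  shows "Phi u = (\<Sum>k\<in>A. phi k (wc k u))"
  unfolding Phi_def
  by (rule sum.mono_neutral_left) (use assms in \<open>auto simp: phi_zero\<close>)

lemma Phi_homogeneous: "u \<in> V k \<Longrightarrow> Phi u = phi k u"
  by (subst Phi_superset[of "{k}"]) (auto simp: wc_homogeneous split: if_splits)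

lemma Phi_lin: "lin Phi"
proof (rule linI)
  fix u w
  let ?A = "{k. wc k u \<noteq> 0} \<union> {k. wc k w \<noteq> 0}"
  have "Phi x = (\<Sum>k\<in>?A. phi k (wc k x))" if "x \<in> {u, w, u + w}" for x
    by (rule Phi_superset) (use that in \<open>auto simp: wc_support lin_add[OF wc_lin]\<close>)
  then show "Phi (u + w) = Phi u + Phi w"
    by (simp add: lin_add[OF wc_lin] phi_add[OF wc_V wc_V] sum.distrib)
next
  fix c u
  have "Phi x = (\<Sum>k | wc k u \<noteq> 0. phi k (wc k x))" if "x \<in> {u, sm c u}" for x
    by (rule Phi_superset) (use that in \<open>auto simp: wc_support lin_scale[OF wc_lin]\<close>)
  then show "Phi (sm c u) = sm c (Phi u)"
    by (simp add: lin_scale[OF wc_lin] phi_scale[OF wc_V] scale_sum_right)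
qed

lemma Phi_eigen: "u \<in> V k \<Longrightarrow> zhuL0 (Phi u) = sm (of_int k) (Phi u)"
  and Phi_lead_homogeneous: "u \<in> V k \<Longrightarrow> Phi u - u \<in> W (k - 1)"
  by (simp_all add: Phi_homogeneous phi_eigen phi_lead)

lemma Phi_eqI:
  "u \<in> V k \<Longrightarrow> zhuL0 u' = sm (of_int k) u' \<Longrightarrow> u' - u \<in> W (k - 1) \<Longrightarrow> Phi u = u'"
  by (simp add: Phi_homogeneous phi_eqI)

lemma Phi_lead: "v \<in> W k \<Longrightarrow> Phi v - v \<in> W (k - 1)"
  using W_lin[OF lin_sub[OF Phi_lin lin_id], of "-1"] Phi_lead_homogeneous by simp

text \<open>If \<open>Phi v = 0\<close>, then v equals -(Phi v - v), which lies one step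
  lower.\<close>

lemma Phi_inj: "Phi v = 0 \<Longrightarrow> v = 0"
proof (induction v rule: W_induct)
  case (2 k v)
  then have "sm (-1) (Phi v - v) \<in> W (k - 1)" by (intro W_scale Phi_lead)
  then have "v \<in> W (k - 1)" using 2(3) by (simp add: scale_minus_left)
  then show ?case using 2 by blast
qed simp

text \<open>A preimage x of the lower term \<open>Phi v - v\<close> exists by induction, and then
  \<open>v - x\<close> is a preimage of v.\<close>

lemma Phi_surj: "\<exists>x. Phi x = v"
proof (induction v rule: W_induct)
  case 1
  show ?case using lin_zero[OF Phi_lin] by blast
next
  case (2 k v)
  then obtain x where "Phi x = Phi v - v" using Phi_lead by blast
  then have "Phi (v - x) = v" by (simp add: lin_diff[OF Phi_lin])
  then show ?case by blast
qed

text \<open>The nonnegative modes of \<open>om\<close> kill the vacuum, so it is an eigenvector of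
  L(0) and of L[0] for the same eigenvalue 0.\<close>

lemma Phi_vac: "Phi vac = vac"
proof -
  have z: "Y om j vac = 0" if "j \<ge> 0" for j
    using va that by (simp add: is_vertex_algebra_def)
  have "zhuL0 vac = 0"
    by (subst zhuL0_eq_sum[of 0]) (simp_all add: z)
  moreover have "vac \<in> V 0" by (simp add: V_iff Vir_def z)
  ultimately show ?thesis by (intro Phi_eqI[of vac 0]) simp_all
qed

text \<open>The series \<open>dlg n * tw p\<close> has order n and leading coefficient 1; its first
  term gives a_n b, and every later mode lowers the weight further. The bound is p + q - n - 2, one
  below the weight of a_n b, bracketed as \<open>W_bilin\<close> expects.\<close>

lemma tmode_lead:
  assumes a: "a \<in> V p" and b: "b \<in> V q"
  shows "tmode (dlg n) a b - Y a n b \<in> W (q + (p + (- n - 2)))"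
proof -
  obtain J where J: "\<And>j. j \<ge> J \<Longrightarrow> Y a j b = 0" using Y_truncation by blast
  define G where "G = dlg n * tw p"
  have ord: "ord_ge n G"
    using ord_ge_mult[OF dlg_ord, of 0 "tw p"] by (simp add: G_def ord_ge_def tw_nth)
  have lead: "G $$ n = 1"
  proof -
    have "fls_subdegree (dlg n) = n"
      by (rule fls_subdegree_eqI) (use dlg_ord dlg_lead in \<open>auto simp: ord_ge_def\<close>)
    moreover have "fls_subdegree (1 + fls_X :: complex fls) = 0"
      by (rule fls_subdegree_eqI) auto
    ultimately show ?thesis
      using fls_times_base[of "dlg n" "tw p"] by (simp add: G_def dlg_lead tw_nth)
  qed
  have "tmode (dlg n) a b = mode G a b" by (simp add: tmode_homogeneous[OF a] G_def)
  also have "\<dots> = (\<Sum>j\<in>{n..<max J (n + 1)}. sm (G $$ j) (Y a j b))"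
    by (rule mode_eq_sum[OF ord]) (simp add: J)
  also have "{n..<max J (n + 1)} = insert n {n + 1..<max J (n + 1)}" by auto
  also have "(\<Sum>j\<in>\<dots>. sm (G $$ j) (Y a j b))
     = Y a n b + (\<Sum>j\<in>{n + 1..<max J (n + 1)}. sm (G $$ j) (Y a j b))"
    by (simp add: lead)
  finally have "tmode (dlg n) a b - Y a n b = (\<Sum>j\<in>{n + 1..<max J (n + 1)}. sm (G $$ j) (Y a j b))"
    by simp
  also have "\<dots> \<in> W (q + (p + (- n - 2)))"
    by (intro W_sum W_scale V_W[OF Y_weight[OF a b]]) simp
  finally show ?thesis .
qed

lemma W_bilin:
  assumes "\<And>a. lin (B a)" "\<And>b. lin (\<lambda>a. B a b)"
    and "\<And>p q a b. a \<in> V p \<Longrightarrow> b \<in> V q \<Longrightarrow> B a b \<in> W (q + (p + d))"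
    and a: "a \<in> W p" and b: "b \<in> W q"
  shows "B a b \<in> W (p + q + d)"
proof -
  have "B a' b \<in> W (p' + (q + d))" if "a' \<in> V p'" for a' p'
    using W_lin[OF assms(1) assms(3)[OF that] b] by (simp add: add_ac)
  from W_lin[OF assms(2) this a] show ?thesis by (simp add: add_ac)
qed

lemma Phi_Y: "Phi (Y u n v) = tmode (dlg n) (Phi u) (Phi v)"
proof (rule lin_eq_homogeneous[of "\<lambda>u. Phi (Y u n v)" "\<lambda>u. tmode (dlg n) (Phi u) (Phi v)"])
  show "lin (\<lambda>u. Phi (Y u n v))" by (rule lin_comp[OF Phi_lin Y_lin_left])
  show "lin (\<lambda>u. tmode (dlg n) (Phi u) (Phi v))" by (rule lin_comp[OF tmode_lin_left Phi_lin])
  fix k u assume u: "u \<in> V k"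
  show "Phi (Y u n v) = tmode (dlg n) (Phi u) (Phi v)"
  proof (rule lin_eq_homogeneous[of "\<lambda>v. Phi (Y u n v)" "\<lambda>v. tmode (dlg n) (Phi u) (Phi v)"])
    show "lin (\<lambda>v. Phi (Y u n v))" by (rule lin_comp[OF Phi_lin Y_lin])
    show "lin (\<lambda>v. tmode (dlg n) (Phi u) (Phi v))" by (rule lin_comp[OF tmode_lin Phi_lin])
    fix l v assume v: "v \<in> V l"
    let ?x = "tmode (dlg n) (Phi u) (Phi v)"
    show "Phi (Y u n v) = ?x"
    proof (rule Phi_eqI[OF Y_weight[OF u v]])
      \<comment> \<open>By \<open>tmode_derivation\<close> the eigenvalue is k + l - (n + 1): k and
        l come from the two arguments, n + 1 from the form x^n dx. It equals the weight of u_n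
        v.\<close>
      have "fls_deriv (dlg n * xlog) = fls_const (of_int (n + 1)) * dlg n"
        using dlg_xlog_deriv by (simp only: fls_of_int)
      then have "zhuL0 ?x = sm (of_int l) ?x + sm (of_int k) ?x - sm (of_int (n + 1)) ?x"
        by (simp only: tmode_derivation Phi_eigen[OF u] Phi_eigen[OF v] lin_scale[OF tmode_lin]
            lin_scale[OF tmode_lin_left] cont_const_mult[OF cont_tmode])
      then show "zhuL0 ?x = sm (of_int (k + l - n - 1)) ?x"
        by (simp add: scale_left_distrib scale_left_diff_distrib algebra_simps)
      have uW: "Phi u \<in> W k" using W_add[OF W_mono[OF Phi_lead_homogeneous[OF u], of k] V_W[OF u]] by simp
      have vW: "Phi v \<in> W l" using W_add[OF W_mono[OF Phi_lead_homogeneous[OF v], of l] V_W[OF v]] by simp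
      have YW: "Y a n b \<in> W (p + q + (- n - 1))" if "a \<in> W p" "b \<in> W q" for a b p q
        by (rule W_bilin[OF Y_lin Y_lin_left _ that])
           (auto intro: V_W[OF Y_weight])
      have ZW: "tmode (dlg n) a b - Y a n b \<in> W (p + q + (- n - 2))" if "a \<in> W p" "b \<in> W q" for a b p q
        by (rule W_bilin[of "\<lambda>a b. tmode (dlg n) a b - Y a n b", OF _ _ tmode_lead that])
           (intro lin_sub tmode_lin tmode_lin_left Y_lin Y_lin_left; assumption)+
      \<comment> \<open>Three errors, each below the top weight: replacing the twisted mode by the
        plain one, and the lower parts of \<open>Phi u\<close> and of \<open>Phi v\<close>.\<close>
      have "?x - Y u n v = (?x - Y (Phi u) n (Phi v)) + Y (Phi u - u) n (Phi v) + Y u n (Phi v - v)"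
        by (simp add: lin_diff[OF Y_lin] lin_diff[OF Y_lin_left])
      also have "\<dots> \<in> W (k + l - n - 1 - 1)"
        using ZW[OF uW vW] YW[OF Phi_lead_homogeneous[OF u] vW]
          YW[OF V_W[OF u order_refl] Phi_lead_homogeneous[OF v]]
        by (intro W_add) (simp_all add: algebra_simps)
      finally show "?x - Y u n v \<in> W (k + l - n - 1 - 1)" .
    qed
  qed
qed

lemma Y_vac_right: "Y u (-1) vac = u" and Y_vac_right_nonneg: "j \<ge> 0 \<Longrightarrow> Y u j vac = 0"
  using va by (simp_all add: is_vertex_algebra_def)

lemma Y_vac_translate: "Y u (-2) vac = L (-1) u"
  using Y_translate[of u "-1" vac] by (simp add: Y_vac_right)

text \<open>Nonnegative modes kill the vacuum, so only the coefficients of y^(-2) and y^(-1) count.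
  \<open>dlg (-2)\<close> has no residue, hence the latter is k, coming from (1+y)^k. This is the
  origin of L(0) in the generators L(-1) + L(0) + m - n.\<close>

lemma tmode_vac: "tmode (dlg (-2)) a vac = L (-1) a + L 0 a"
proof (rule lin_eq_homogeneous[of "\<lambda>a. tmode (dlg (-2)) a vac" "\<lambda>a. L (-1) a + L 0 a"])
  show "lin (\<lambda>a. tmode (dlg (-2)) a vac)" by (rule tmode_lin_left)
  show "lin (\<lambda>a. L (-1) a + L 0 a)" by (intro lin_plus L_lin)
  fix k a assume a: "a \<in> V k"
  define G where "G = dlg (-2) * tw k"
  have sd: "fls_subdegree (dlg (-2)) = -2"
    by (rule fls_subdegree_eqI) (use dlg_ord[of "-2"] dlg_lead[of "-2"] in \<open>auto simp: ord_ge_def\<close>)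
  have sx: "fls_subdegree (1 + fls_X :: complex fls) = 0"
    by (rule fls_subdegree_eqI) auto
  have res: "dlg (-2) $$ (-1) = 0" using dlg_residue[of "-2" "-1"] by simp
  have "ord_ge (-2) G"
    using ord_ge_mult[OF dlg_ord[of "-2"], of 0 "tw k"] by (simp add: G_def ord_ge_def tw_nth)
  then have "mode G a vac = (\<Sum>j\<in>{-2..<0}. sm (G $$ j) (Y a j vac))"
    by (rule mode_eq_sum) (simp add: Y_vac_right_nonneg)
  also have "{-2..<0::int} = {-2, -1}" by auto
  finally have "mode G a vac = sm (G $$ (-2)) (Y a (-2) vac) + sm (G $$ (-1)) a"
    by (simp add: Y_vac_right)
  moreover have "G $$ (-2) = 1"
    unfolding G_def fls_times_nth(2) by (simp add: sd sx dlg_lead tw_nth)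
  moreover have "G $$ (-1) = of_int k"
  proof -
    have "{-2..-1::int} = {-2, -1}" by auto
    then show ?thesis
      unfolding G_def fls_times_nth(2) by (simp add: sd sx dlg_lead tw_nth res)
  qed
  ultimately show "tmode (dlg (-2)) a vac = L (-1) a + L 0 a"
    using a by (simp add: tmode_homogeneous[OF a] G_def Y_vac_translate V_iff)
qed

lemma Phi_translate: "Phi (Y u (-2) vac) = L (-1) (Phi u) + L 0 (Phi u)"
  by (simp add: Phi_Y Phi_vac tmode_vac)

section \<open>The residues defining the two families of products\<close>

lemma resVOA_mode: "resVOA sm Y a k u v = mode (fps_to_fls (fps_binomial a) * fls_X powi (- k)) u v"
proof -
  have "(G * fls_X powi (- j - 1)) $$ (-1) = G $$ j" for G :: "complex fls" and j
    by (simp only: fls_X_power_int fls_X_intpow_times_conv_shift) simp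
  then show ?thesis unfolding resVOA_def resY_def mode_def by simp
qed

text \<open>The weight enters the exponent additively, so (1+z)^wt splits off as the twist
  \<open>tw\<close>.\<close>

lemma resVOA_twist:
  "resVOA sm Y (of_int j + a) k u v
     = mode (fps_to_fls (fps_binomial a) * fls_X powi (- k) * tw j) u v"
  by (simp only: resVOA_mode fps_binomial_add_mult fls_times_fps_to_fls one_plus_fls_X_powi_eq mult_ac)

text \<open>Res_y G(y) Y(u, log(1+y)) v.\<close>
definition resL :: "complex fls \<Rightarrow> 'v \<Rightarrow> 'v \<Rightarrow> 'v" where
  "resL G u v = resY sm Y (\<lambda>j. G * lg powi (- j - 1)) u v"

lemma resL_eq_sum:
  assumes "ord_ge I G" "\<And>j. j \<ge> J \<Longrightarrow> Y u j v = 0"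
  shows "resL G u v = (\<Sum>j\<in>{I..<J}. sm ((G * lg powi (- j - 1)) $$ (-1)) (Y u j v))"
  unfolding resL_def resY_def
proof (rule sum.mono_neutral_left)
  show "{j. Y u j v \<noteq> 0 \<and> (G * lg powi (- j - 1)) $$ (-1) \<noteq> 0} \<subseteq> {I..<J}"
  proof
    fix j assume j: "j \<in> {j. Y u j v \<noteq> 0 \<and> (G * lg powi (- j - 1)) $$ (-1) \<noteq> 0}"
    have "ord_ge (- j - 1) (lg powi (- j - 1))"
      using ord_ge_subdegree[of "lg powi (- j - 1)"] by simp
    \<comment> \<open>The product has order at least I - j - 1, which exceeds -1 for j < I, so its
      residue vanishes.\<close>
    from ord_ge_mult[OF assms(1) this] have "\<not> j < I" using j by (auto simp: ord_ge_def)
    moreover have "\<not> J \<le> j" using assms(2)[of j] j by auto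
    ultimately show "j \<in> {I..<J}" by auto
  qed
qed auto

lemma cont_resL: "cont (\<lambda>G. resL G u v)"
proof -
  obtain J where J: "\<And>j. j \<ge> J \<Longrightarrow> Y u j v = 0" using Y_truncation by blast
  show ?thesis
  proof (rule contI[where K = J])
    fix G H :: "complex fls"
    define I where "I = min (fls_subdegree G) (fls_subdegree H)"
    have "ord_ge I G" "ord_ge I H" "ord_ge I (G + H)"
      by (auto simp: ord_ge_def I_def)
    then show "resL (G + H) u v = resL G u v + resL H u v"
      by (simp add: resL_eq_sum[OF _ J] distrib_right scale_left_distrib sum.distrib)
  next
    fix c and G :: "complex fls"
    have "ord_ge (fls_subdegree G) G" "ord_ge (fls_subdegree G) (fls_const c * G)"
      by (auto simp: ord_ge_def)
    then show "resL (fls_const c * G) u v = sm c (resL G u v)"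
      by (simp add: resL_eq_sum[OF _ J] scale_sum_right mult.assoc)
  next
    fix G :: "complex fls" assume "ord_ge J G"
    then show "resL G u v = 0" by (simp add: resL_eq_sum[OF _ J])
  qed
qed

lemma resL_dlg: "resL (dlg n) u v = Y u n v"
proof -
  obtain J where J: "\<And>j. j \<ge> J \<Longrightarrow> Y u j v = 0" using Y_truncation by blast
  have "resL (dlg n) u v = (\<Sum>j\<in>{n..<max J (n + 1)}. sm (if j = n then 1 else 0) (Y u j v))"
    using resL_eq_sum[OF dlg_ord, of "max J (n + 1)" u v n] J by (simp add: dlg_residue)
  also have "\<dots> = (\<Sum>j\<in>{n}. sm (if j = n then 1 else 0) (Y u j v))"
    by (rule sum.mono_neutral_right) auto
  finally show ?thesis by simp
qed

text \<open>For \<open>G = dlg n\<close> the residue is the single mode u_n v by duality, and the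
  claim is \<open>Phi_Y\<close>; both sides are \<open>cont\<close> in \<open>G\<close>.\<close>

lemma Phi_resL: "Phi (resL G u v) = tmode G (Phi u) (Phi v)"
  by (rule cont_eqI[OF cont_lin[OF Phi_lin cont_resL] cont_tmode, where F = dlg])
     (simp_all add: dlg_ord dlg_lead resL_dlg Phi_Y)

lemma Phi_resVA:
  "Phi (resVA sm Y a k u v)
     = tmode (fps_to_fls (fps_binomial a) * fls_X powi (- k)) (Phi u) (Phi v)"
  using Phi_resL unfolding resVA_def resL_def lg_def .

text \<open>The weight occurs in the product only through the exponent of 1+z. Summing over
  homogeneous components therefore gives \<open>tmode\<close> with the very series and coefficients
  of the vertex algebra side.\<close>

lemma star_rk_sum:
  "(\<Sum>k | wc k u \<noteq> 0. star_rk sm Y T r k M P N (wc k u) v)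
     = (if cond T r P N then
        (\<Sum>i\<in>{0..P div T}. sm ((-1)^i * (of_int (Aexp T r M P N + int i) gchoose i))
          (tmode (fps_to_fls (fps_binomial (-1 + of_nat (M div T) + of_int (dlt T (M mod T) r)
                + of_nat r / of_nat T)) * fls_X powi (- (Aexp T r M P N + 1 + int i))) u v))
      else 0)"
proof -
  have "of_int k - 1 + of_nat (M div T) + of_int (dlt T (M mod T) r) + of_nat r / of_nat T
    = of_int k + (-1 + of_nat (M div T) + of_int (dlt T (M mod T) r) + of_nat r / of_nat T :: complex)"
    for k by simp
  then show ?thesis
    unfolding star_rk_def tmode_def scale_sum_right
    by (simp only: resVOA_twist if_distrib sum.neutral_const) (auto intro: sum.swap)
qed

lemma circ_rk_sum:
  "(\<Sum>k | wc k u \<noteq> 0. circ_rk sm Y T r k M N (wc k u) v)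
     = tmode (fps_to_fls (fps_binomial (-1 + of_int (dlt T (M mod T) r) + of_nat (M div T)
            + of_nat r / of_nat T)) * fls_X powi
          (- (int (M div T) + int (N div T) + dlt T (M mod T) r + dlt T (N mod T) (T - r) + 1))) u v"
proof -
  have "of_int k - 1 + of_nat (M div T) + of_int (dlt T (M mod T) r) + of_nat r / of_nat T
    = of_int k + (-1 + of_int (dlt T (M mod T) r) + of_nat (M div T) + of_nat r / of_nat T :: complex)"
    for k by simp
  then show ?thesis
    unfolding circ_rk_def tmode_def by (simp only: resVOA_twist)
qed

lemma Phi_bul_r:
  "Phi (bul_r sm Y T r M P N u v)
     = (\<Sum>k | wc k (Phi u) \<noteq> 0. star_rk sm Y T r k M P N (wc k (Phi u)) (Phi v))"
  unfolding bul_r_def star_rk_sum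
  by (simp add: lin_sum[OF Phi_lin] lin_scale[OF Phi_lin] Phi_resVA lin_zero[OF Phi_lin]
      del: fls_X_power_int)

lemma Phi_dia_r:
  "Phi (dia_r sm Y T r M N u v)
     = (\<Sum>k | wc k (Phi u) \<noteq> 0. circ_rk sm Y T r k M N (wc k (Phi u)) (Phi v))"
  unfolding dia_r_def circ_rk_sum by (rule Phi_resVA)

section \<open>Transport of the quotients\<close>

lemma span_image: "lin f \<Longrightarrow> f ` span B = span (f ` B)"
  by (metis Vector_Spaces.linear_def module_hom.span_image)

text \<open>Every generator on the right is the image of a generator on the left because its entries
  have preimages under \<open>Phi\<close>; linearity then passes to spans.\<close>

lemma O3_image:
  assumes pr: "\<And>M P N u v. Phi (pr M P N u v) = pr' M P N (Phi u) (Phi v)"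
    and Q: "\<And>N M. Phi ` Q N M = Q' N M"
  shows "Phi ` O3 sm pr Q N M = O3 sm pr' Q' N M"
proof -
  have "Phi ` {pr M P3 N u (pr M P1 P3 (pr P1 P2 P3 a b) c - pr M P2 P3 a (pr M P1 P2 b c))
           | u a b c P1 P2 P3. True}
     = {pr' M P3 N u (pr' M P1 P3 (pr' P1 P2 P3 a b) c - pr' M P2 P3 a (pr' M P1 P2 b c))
           | u a b c P1 P2 P3. True}" (is "Phi ` ?A = ?A'")
  proof
    show "Phi ` ?A \<subseteq> ?A'" by (auto simp: pr lin_diff[OF Phi_lin]) blast
    show "?A' \<subseteq> Phi ` ?A"
    proof
      fix x assume "x \<in> ?A'"
      then obtain u a b c P1 P2 P3 where x: "x = pr' M P3 N u
          (pr' M P1 P3 (pr' P1 P2 P3 a b) c - pr' M P2 P3 a (pr' M P1 P2 b c))" by blast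
      obtain u' a' b' c' where "u = Phi u'" "a = Phi a'" "b = Phi b'" "c = Phi c'"
        using Phi_surj by metis
      then have "x = Phi (pr M P3 N u' (pr M P1 P3 (pr P1 P2 P3 a' b') c' - pr M P2 P3 a' (pr M P1 P2 b' c')))"
        by (simp add: x pr lin_diff[OF Phi_lin])
      then show "x \<in> Phi ` ?A" by blast
    qed
  qed
  moreover have "Phi ` {pr M P1 N (pr P1 P2 N a x) b | a b x P1 P2. x \<in> Q P2 P1}
    = {pr' M P1 N (pr' P1 P2 N a x) b | a b x P1 P2. x \<in> Q' P2 P1}" (is "Phi ` ?B = ?B'")
  proof
    show "Phi ` ?B \<subseteq> ?B'" by (auto simp: pr Q[symmetric]) blast
    show "?B' \<subseteq> Phi ` ?B"
    proof
      fix y assume "y \<in> ?B'"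
      then obtain a b x P1 P2 where y: "y = pr' M P1 N (pr' P1 P2 N a x) b" and "x \<in> Q' P2 P1"
        by blast
      then obtain x' where x': "x' \<in> Q P2 P1" "x = Phi x'" using Q by blast
      obtain a' b' where "a = Phi a'" "b = Phi b'" using Phi_surj by metis
      then have "y = Phi (pr M P1 N (pr P1 P2 N a' x') b')" by (simp add: y x' pr)
      then show "y \<in> Phi ` ?B" using x' by blast
    qed
  qed
  ultimately show ?thesis
    unfolding O3_def by (simp only: span_image[OF Phi_lin] image_Un Q)
qed

text \<open>Injectivity turns the equality of images into an equivalence of memberships;
  \<open>0 \<in> A\<close> puts the zero difference \<open>y - Phi x\<close> into
  \<open>B\<close>.\<close>

lemma quot_iso_Phi:
  assumes "Phi ` A = B" "0 \<in> A"
  shows "quot_iso sm A B Phi"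
  unfolding quot_iso_def
proof (intro conjI allI)
  show "lin Phi" by (rule Phi_lin)
  fix x
  show "Phi x \<in> B \<longleftrightarrow> x \<in> A"
  proof
    assume "Phi x \<in> B"
    then obtain a where "a \<in> A" "Phi x = Phi a" using assms by blast
    then have "Phi (x - a) = 0" by (simp add: lin_diff[OF Phi_lin])
    then show "x \<in> A" using Phi_inj[of "x - a"] \<open>a \<in> A\<close> by simp
  qed (use assms in blast)
next
  fix y
  obtain x where x: "Phi x = y" using Phi_surj by blast
  have "0 \<in> B" using assms lin_zero[OF Phi_lin] by force
  then show "\<exists>x. y - Phi x \<in> B" using x by (intro exI[of _ x]) simp
qed

end

section \<open>Compatibility with the automorphism\<close>

locale voa_automorphism = voa sm Y vac om
  for sm :: "complex \<Rightarrow> 'v::ab_group_add \<Rightarrow> 'v" and Y vac om +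
  fixes g :: "'v \<Rightarrow> 'v"
  assumes aut: "is_automorphism sm Y vac om g"
begin

lemma g_lin: "lin g" and g_Y: "g (Y u n v) = Y (g u) n (g v)" and g_om: "g om = om"
  using aut by (simp_all add: is_automorphism_def)

lemma g_V: "v \<in> V k \<Longrightarrow> g v \<in> V k"
  using g_Y[of om 1 v] by (simp add: V_iff Vir_def g_om lin_scale[OF g_lin])

lemma g_zhuL0: "g (zhuL0 v) = zhuL0 (g v)"
proof -
  obtain I where I: "\<forall>i\<ge>I. Y om (int i) v = 0" using Y_truncation_nat by blast
  have "Y om j (g v) = g (Y om j v)" for j by (simp add: g_Y g_om)
  then have "\<forall>i\<ge>I. Y om (int i) (g v) = 0" using I by (simp add: lin_zero[OF g_lin])
  then show ?thesis
    by (simp add: zhuL0_eq_sum[OF I] zhuL0_eq_sum lin_sum[OF g_lin] lin_scale[OF g_lin] g_Y g_om)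
qed

lemma g_W: "v \<in> W k \<Longrightarrow> g v \<in> W k"
  using W_lin[OF g_lin, of 0 v k] V_W[OF g_V] by simp

text \<open>\<open>g\<close> commutes with L[0] and preserves weights, so \<open>g (Phi v)\<close>
  has the eigenvalue and leading term that characterise \<open>Phi (g v)\<close>.\<close>

lemma Phi_g: "Phi (g v) = g (Phi v)"
proof (rule lin_eq_homogeneous[of "\<lambda>v. Phi (g v)" "\<lambda>v. g (Phi v)"])
  show "lin (\<lambda>v. Phi (g v))" by (rule lin_comp[OF Phi_lin g_lin])
  show "lin (\<lambda>v. g (Phi v))" by (rule lin_comp[OF g_lin Phi_lin])
  fix k v assume v: "v \<in> V k"
  show "Phi (g v) = g (Phi v)"
  proof (rule Phi_eqI[OF g_V[OF v]])
    show "zhuL0 (g (Phi v)) = sm (of_int k) (g (Phi v))"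
      by (simp add: g_zhuL0[symmetric] Phi_eigen[OF v] lin_scale[OF g_lin])
    show "g (Phi v) - g v \<in> W (k - 1)"
      using g_W[OF Phi_lead_homogeneous[OF v]] by (simp add: lin_diff[OF g_lin])
  qed
qed

lemma Phi_projr: "Phi (projr sm g T r v) = projr sm g T r (Phi v)"
proof -
  have "Phi ((g ^^ k) v) = (g ^^ k) (Phi v)" for k
    by (induction k) (simp_all add: Phi_g)
  then show ?thesis
    by (simp add: projr_def lin_scale[OF Phi_lin] lin_sum[OF Phi_lin])
qed

lemma Phi_bul: "Phi (bul sm Y g T M P N u v) = star sm Y om g T M P N (Phi u) (Phi v)"
  by (simp add: bul_def star_def lin_sum[OF Phi_lin] Phi_bul_r Phi_projr)

lemma Phi_dia: "Phi (dia sm Y g T M N u v) = circ sm Y om g T M N (Phi u) (Phi v)"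
  by (simp add: dia_def circ_def lin_sum[OF Phi_lin] Phi_dia_r Phi_projr)

lemma Phi_tO1: "Phi ` tO1 sm Y vac g T N M = O1 sm Y om g T N M"
proof -
  have "Phi ` {dia sm Y g T M N u v | u v. True} = {circ sm Y om g T M N u v | u v. True}"
    (is "Phi ` ?A = ?A'")
  proof
    show "Phi ` ?A \<subseteq> ?A'" by (auto simp: Phi_dia) blast
    show "?A' \<subseteq> Phi ` ?A"
    proof
      fix x assume "x \<in> ?A'"
      then obtain u v where x: "x = circ sm Y om g T M N u v" by blast
      obtain u' v' where "u = Phi u'" "v = Phi v'" using Phi_surj by metis
      then have "x = Phi (dia sm Y g T M N u' v')" by (simp add: x Phi_dia)
      then show "x \<in> Phi ` ?A" by blast
    qed
  qed
  moreover have "Phi ` {Y u (-2) vac + sm ((of_nat M - of_nat N) / of_nat T) u | u. True}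
     = {L (-1) u + L 0 u + sm ((of_nat M - of_nat N) / of_nat T) u | u. True}"
    (is "Phi ` ?B = ?B'")
  proof
    have eq: "Phi (Y u (-2) vac + sm c u) = L (-1) (Phi u) + L 0 (Phi u) + sm c (Phi u)" for u c
      by (simp add: lin_add[OF Phi_lin] lin_scale[OF Phi_lin] Phi_translate)
    show "Phi ` ?B \<subseteq> ?B'" by (auto simp: eq)
    show "?B' \<subseteq> Phi ` ?B"
    proof
      fix x assume "x \<in> ?B'"
      then obtain u where x: "x = L (-1) u + L 0 u + sm ((of_nat M - of_nat N) / of_nat T) u" by blast
      obtain u' where "u = Phi u'" using Phi_surj by metis
      then have "x = Phi (Y u' (-2) vac + sm ((of_nat M - of_nat N) / of_nat T) u')"
        by (simp add: x eq)
      then show "x \<in> Phi ` ?B" by blast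
    qed
  qed
  ultimately show ?thesis
    unfolding tO1_def O1_def by (simp only: span_image[OF Phi_lin] image_Un)
qed

lemma Phi_tO: "Phi ` tO sm Y vac g T N M = Ovoa sm Y om g T N M"
  unfolding tO_def Ovoa_def by (rule O3_image) (simp_all add: Phi_bul Phi_tO1)

lemma alg_iso_Phi:
  "alg_iso sm (tO1 sm Y vac g T N N) (bul sm Y g T N N N)
     (O1 sm Y om g T N N) (star sm Y om g T N N N) Phi"
  unfolding alg_iso_def
  by (auto intro!: quot_iso_Phi Phi_tO1 simp: Phi_bul) (simp_all add: tO1_def O1_def span_zero)

lemma quot_iso_Phi_tO: "quot_iso sm (tO sm Y vac g T N M) (Ovoa sm Y om g T N M) Phi"
  by (rule quot_iso_Phi[OF Phi_tO]) (simp add: tO_def O3_def span_zero)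

end

theorem theorem8p8:
  fixes sm :: "complex \<Rightarrow> 'v::ab_group_add \<Rightarrow> 'v"
    and Y :: "'v \<Rightarrow> int \<Rightarrow> 'v \<Rightarrow> 'v"
    and vac om :: 'v
    and g :: "'v \<Rightarrow> 'v"
    and T :: nat
  assumes "is_VOA sm Y vac om"
    and "is_automorphism sm Y vac om g"
    and "has_order g T"
  shows "(\<forall>N. \<exists>phi. alg_iso sm
              (tO1 sm Y vac g T N N) (bul sm Y g T N N N)
              (O1 sm Y om g T N N) (star sm Y om g T N N N) phi)
       \<and> (\<forall>N M. \<exists>psi phin phim.
              alg_iso sm (tO1 sm Y vac g T N N) (bul sm Y g T N N N)
                         (O1 sm Y om g T N N) (star sm Y om g T N N N) phin
            \<and> alg_iso sm (tO1 sm Y vac g T M M) (bul sm Y g T M M M)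
                         (O1 sm Y om g T M M) (star sm Y om g T M M M) phim
            \<and> quot_iso sm (tO sm Y vac g T N M) (Ovoa sm Y om g T N M) psi
            \<and> (\<forall>a x. psi (bul sm Y g T M N N a x)
                      - star sm Y om g T M N N (phin a) (psi x) \<in> Ovoa sm Y om g T N M)
            \<and> (\<forall>x b. psi (bul sm Y g T M M N x b)
                      - star sm Y om g T M M N (psi x) (phim b) \<in> Ovoa sm Y om g T N M))"
proof -
  interpret voa_automorphism sm Y vac om g
    by unfold_locales (use assms in auto)
  have zero: "0 \<in> Ovoa sm Y om g T N M" for N M
    by (simp add: Ovoa_def O3_def span_zero)
  show ?thesis
  proof (intro conjI allI)
    show "\<exists>phi. alg_iso sm (tO1 sm Y vac g T N N) (bul sm Y g T N N N)
              (O1 sm Y om g T N N) (star sm Y om g T N N N) phi" for N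
      using alg_iso_Phi by blast
    fix N M
    show "\<exists>psi phin phim.
              alg_iso sm (tO1 sm Y vac g T N N) (bul sm Y g T N N N)
                         (O1 sm Y om g T N N) (star sm Y om g T N N N) phin
            \<and> alg_iso sm (tO1 sm Y vac g T M M) (bul sm Y g T M M M)
                         (O1 sm Y om g T M M) (star sm Y om g T M M M) phim
            \<and> quot_iso sm (tO sm Y vac g T N M) (Ovoa sm Y om g T N M) psi
            \<and> (\<forall>a x. psi (bul sm Y g T M N N a x)
                      - star sm Y om g T M N N (phin a) (psi x) \<in> Ovoa sm Y om g T N M)
            \<and> (\<forall>x b. psi (bul sm Y g T M M N x b)
                      - star sm Y om g T M M N (psi x) (phim b) \<in> Ovoa sm Y om g T N M)"
      \<comment> \<open>The single map \<open>Phi\<close> serves as \<open>psi\<close>,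
        \<open>phin\<close> and \<open>phim\<close>. It intertwines the products exactly, so all the
        required differences are 0.\<close>
      by (intro exI[of _ Phi] conjI allI alg_iso_Phi quot_iso_Phi_tO) (simp_all add: Phi_bul zero)
  qed
qed

end
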